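(* Let $\Gamma$ be a finitely generated group acting continuously on a compact metric space $Y$, and assume that the action $\Gamma \curvearrowright Y$ is free. If the warped cone $\mathcal{O}_\Gamma Y$ has property A, then the action $\Gamma\curvearrowright Y$ is amenable.
   Context: Warped cone. Let $\Gamma$ be a group with a fixed finite generating set $S$, acting continuously on a compact metric space $(Y,d)$ with $\operatorname{diam}(Y)>0$. The infinite cone $\mathcal{O}Y$ is $(0,\infty)\times Y$ with the metric $d((r,y),(r',y')) = |r-r'|\cdot\operatorname{diam}(Y)+\min(r,r')\cdot d(y,y')$ and the action $\gamma(r,y)=(r,\gamma y)$. The warped cone $\mathcal{O}_\Gamma Y$ is $\mathcal{O}Y$ equipped with the warped metric $d_\Gamma$: the largest metric on $\mathcal{O}Y$ such that $d_\Gamma\le d$ and $d_\Gamma(x,sx)\le 1$ for all $x\in\mathcal{O}Y$, $s\in S$. Property A. A metric space $X$ has property A if there are a sequence of maps $A_n\colon X\to \operatorname{Prob}(X)$ (Borel probability measures on $X$, with total variation norm $\|\cdot\|_1$), $n\geq 1$, and a function $N\colon\mathbb{N}\to\mathbb{N}$ such that $\operatorname{supp}A_n(x)\subseteq B(x,N(n))$ for all $x$, and $\|A_n(x)-A_n(x')\|_1\le 1/n$ whenever $d(x,x')\le n$. Amenable action. An action $\Gamma\curvearrowright Y$ is amenable if there is a sequence of continuous maps $Y\ni y\mapsto C_n^y\in\operatorname{Prob}(\Gamma)$ such that for every $\gamma\in\Gamma$, $\lim_{n\to\infty}\sup_{y\in Y}\|C_n^y\gamma^{-1}-C_n^{\gamma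 y}\|_1=0$, where $(\mu\gamma)(A)=\mu(A\gamma^{-1})$ for $\mu\in\operatorname{Prob}(\Gamma)$, $A\subseteq\Gamma$. Free means that $\gamma y=y$ for some $y\in Y$ implies $\gamma=e$. *)

theory Defs
  imports "HOL-Probability.Probability" "HOL-Algebra.Algebra"
begin

section \<open>Total variation\<close>

text \<open>
  The total variation norm of the signed measure \<open>M - N\<close>, i.e. the total mass of its variation.
  For measures on a countable discrete space this is the \<open>\<ell>\<^sup>1\<close>-distance of the mass functions;
  for probability measures it is twice the supremum of \<open>\<bar>M A - N A\<bar>\<close> over measurable \<open>A\<close>.
\<close>

definition tv_dist :: "'a measure \<Rightarrow> 'a measure \<Rightarrow> real" where
  "tv_dist M N =
     (SUP P\<in>{P. finite P \<and> P \<subseteq> sets M \<and> partition_on (space M) P}.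
        \<Sum>A\<in>P. \<bar>measure M A - measure N A\<bar>)"

lemma prob_sum_partition:
  assumes "prob_space M" "finite P" "P \<subseteq> sets M" "partition_on (space M) P"
  shows "(\<Sum>A\<in>P. measure M A) = 1"
proof -
  interpret prob_space M by fact
  have "disjoint_family_on (\<lambda>A. A) P"
    using assms(4) by (auto simp: partition_on_def disjoint_family_on_def disjoint_def)
  then have "measure M (\<Union>A\<in>P. A) = (\<Sum>A\<in>P. measure M A)"
    using assms by (intro finite_measure_finite_Union) auto
  then show ?thesis
    using assms(4) by (simp add: partition_on_def prob_space)
qed

lemma tv_sum_le_2:
  assumes "prob_space M" "prob_space N" "sets N = sets M"
    and P: "finite P" "P \<subseteq> sets M" "partition_on (space M) P"
  shows "(\<Sum>A\<in>P. \<bar>measure M A - measure N A\<bar>) \<le> 2"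
proof -
  have "(\<Sum>A\<in>P. \<bar>measure M A - measure N A\<bar>) \<le> (\<Sum>A\<in>P. measure M A + measure N A)"
    by (intro sum_mono) (smt (verit) measure_nonneg)
  also have "\<dots> = (\<Sum>A\<in>P. measure M A) + (\<Sum>A\<in>P. measure N A)"
    by (rule sum.distrib)
  also have "\<dots> = 2"
    using prob_sum_partition[OF assms(1) P] prob_sum_partition[OF assms(2) P(1)] P assms(3)
      sets_eq_imp_space_eq[OF assms(3)] by simp
  finally show ?thesis .
qed

section \<open>Property A\<close>

context Metric_space
begin

definition borel_sigma :: "'a measure" where
  "borel_sigma = sigma M {U. openin mtopology U}"

text \<open>
  The set of points all of whose neighbourhoods have positive mass. On separable spaces, such as
  warped cones over compact spaces, its complement is null, so it is the least closed set of full
  measure.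
\<close>

definition msupport :: "'a measure \<Rightarrow> 'a set" where
  "msupport \<mu> = {x \<in> M. \<forall>U. openin mtopology U \<and> x \<in> U \<longrightarrow> 0 < emeasure \<mu> U}"

definition property_A :: bool where
  "property_A \<longleftrightarrow>
     (\<exists>(A :: nat \<Rightarrow> 'a \<Rightarrow> 'a measure) (N :: nat \<Rightarrow> nat). \<forall>n\<ge>1.
        (\<forall>x\<in>M. A n x \<in> space (prob_algebra borel_sigma)) \<and>
        (\<forall>x\<in>M. msupport (A n x) \<subseteq> mball x (real (N n))) \<and>
        (\<forall>x\<in>M. \<forall>x'\<in>M. d x x' \<le> real n \<longrightarrow> tv_dist (A n x) (A n x') \<le> 1 / real n))"

end

section \<open>Actions\<close>

definition acts_continuously ::
    "('g, 'b) monoid_scheme \<Rightarrow> 'y::topological_space set \<Rightarrow> ('g \<Rightarrow> 'y \<Rightarrow> 'y) \<Rightarrow> bool" where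
  "acts_continuously G Y \<phi> \<longleftrightarrow>
     group_action G Y \<phi> \<and> (\<forall>g\<in>carrier G. continuous_on Y (\<phi> g))"

definition acts_freely ::
    "('g, 'b) monoid_scheme \<Rightarrow> 'y set \<Rightarrow> ('g \<Rightarrow> 'y \<Rightarrow> 'y) \<Rightarrow> bool" where
  "acts_freely G Y \<phi> \<longleftrightarrow> (\<forall>g\<in>carrier G. \<forall>y\<in>Y. \<phi> g y = y \<longrightarrow> g = \<one>\<^bsub>G\<^esub>)"

definition right_translate ::
    "('g, 'b) monoid_scheme \<Rightarrow> 'g measure \<Rightarrow> 'g \<Rightarrow> 'g measure" where
  "right_translate G \<mu> \<gamma> = distr \<mu> (count_space (carrier G)) (\<lambda>x. x \<otimes>\<^bsub>G\<^esub> \<gamma>)"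

lemma emeasure_right_translate:
  fixes G (structure)
  assumes "group G" and \<mu>: "\<mu> \<in> space (prob_algebra (count_space (carrier G)))"
    and \<gamma>: "\<gamma> \<in> carrier G" and A: "A \<subseteq> carrier G"
  shows "emeasure (right_translate G \<mu> \<gamma>) A = emeasure \<mu> (A #> inv \<gamma>)"
proof -
  interpret group G by fact
  have s: "sets \<mu> = sets (count_space (carrier G))"
    using \<mu> by (simp add: space_prob_algebra)
  then have sp: "space \<mu> = carrier G"
    using sets_eq_imp_space_eq[OF s] by simp
  have "(\<lambda>x. x \<otimes> \<gamma>) \<in> measurable \<mu> (count_space (carrier G))"
    using \<gamma> by (simp add: measurable_cong_sets[OF s refl])
  moreover have "(\<lambda>x. x \<otimes> \<gamma>) -` A \<inter> space \<mu> = A #> inv \<gamma>"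
  proof (intro Set.set_eqI iffI)
    fix x assume "x \<in> (\<lambda>x. x \<otimes> \<gamma>) -` A \<inter> space \<mu>"
    then have "x = (x \<otimes> \<gamma>) \<otimes> inv \<gamma>" "x \<otimes> \<gamma> \<in> A"
      using \<gamma> sp by (auto simp: m_assoc)
    then show "x \<in> A #> inv \<gamma>"
      unfolding r_coset_def by blast
  next
    fix x assume "x \<in> A #> inv \<gamma>"
    then show "x \<in> (\<lambda>x. x \<otimes> \<gamma>) -` A \<inter> space \<mu>"
      using \<gamma> sp A by (auto simp: r_coset_def m_assoc subset_iff)
  qed
  ultimately show ?thesis
    using A by (simp add: right_translate_def emeasure_distr)
qed

text \<open>
  \<open>Prob(\<Gamma>)\<close> carries the norm topology; on it this agrees with the topology of pointwise
  convergence.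
\<close>

definition amenable_action ::
    "('g, 'b) monoid_scheme \<Rightarrow> 'y::metric_space set \<Rightarrow> ('g \<Rightarrow> 'y \<Rightarrow> 'y) \<Rightarrow> bool" where
  "amenable_action G Y \<phi> \<longleftrightarrow>
     (\<exists>C :: nat \<Rightarrow> 'y \<Rightarrow> 'g measure.
        (\<forall>n. \<forall>y\<in>Y. C n y \<in> space (prob_algebra (count_space (carrier G)))) \<and>
        (\<forall>n. \<forall>y\<in>Y. ((\<lambda>z. tv_dist (C n z) (C n y)) \<longlongrightarrow> 0) (at y within Y)) \<and>
        (\<forall>\<gamma>\<in>carrier G.
           (\<lambda>n. SUP y\<in>Y. tv_dist (right_translate G (C n y) (inv\<^bsub>G\<^esub> \<gamma>)) (C n (\<phi> \<gamma> y)))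
             \<longlonglongrightarrow> 0))"

section \<open>Warped cones\<close>

definition inf_cone :: "'y set \<Rightarrow> (real \<times> 'y) set" where
  "inf_cone Y = {0<..} \<times> Y"

definition cone_dist :: "'y::metric_space set \<Rightarrow> real \<times> 'y \<Rightarrow> real \<times> 'y \<Rightarrow> real" where
  "cone_dist Y p q =
     \<bar>fst p - fst q\<bar> * diameter Y + min (fst p) (fst q) * dist (snd p) (snd q)"

definition cone_action :: "('g \<Rightarrow> 'y \<Rightarrow> 'y) \<Rightarrow> 'g \<Rightarrow> real \<times> 'y \<Rightarrow> real \<times> 'y" where
  "cone_action \<phi> g p = (fst p, \<phi> g (snd p))"

definition warped_admissible ::
    "'y::metric_space set \<Rightarrow> ('g \<Rightarrow> 'y \<Rightarrow> 'y) \<Rightarrow> 'g set \<Rightarrow> (real \<times> 'y \<Rightarrow> real \<times> 'y \<Rightarrow> real) \<Rightarrow> bool"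
  where
  "warped_admissible Y \<phi> S \<delta> \<longleftrightarrow>
     Metric_space (inf_cone Y) \<delta> \<and>
     (\<forall>p\<in>inf_cone Y. \<forall>q\<in>inf_cone Y. \<delta> p q \<le> cone_dist Y p q) \<and>
     (\<forall>p\<in>inf_cone Y. \<forall>s\<in>S. \<delta> p (cone_action \<phi> s p) \<le> 1)"

text \<open>
  The largest admissible metric is the pointwise supremum of all of them, see
  \<open>warped_dist_admissible\<close> and \<open>warped_dist_greatest\<close> below. Off the cone the value is irrelevant;
  it is set to \<open>0\<close> because \<open>Metric_space\<close> asks for nonnegativity and symmetry everywhere.
\<close>

definition warped_dist ::
    "'y::metric_space set \<Rightarrow> ('g \<Rightarrow> 'y \<Rightarrow> 'y) \<Rightarrow> 'g set \<Rightarrow> real \<times> 'y \<Rightarrow> real \<times> 'y \<Rightarrow> real" where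
  "warped_dist Y \<phi> S p q =
     (if p \<in> inf_cone Y \<and> q \<in> inf_cone Y then SUP \<delta>\<in>{\<delta>. warped_admissible Y \<phi> S \<delta>}. \<delta> p q else 0)"

lemma cone_dist_triangle:
  fixes Y :: "'y::metric_space set"
  assumes "bounded Y" "p \<in> inf_cone Y" "q \<in> inf_cone Y" "r \<in> inf_cone Y"
  shows "cone_dist Y p r \<le> cone_dist Y p q + cone_dist Y q r"
proof -
  obtain a x b y c z where pqr: "p = (a, x)" "q = (b, y)" "r = (c, z)"
    by (metis surj_pair)
  then have pos: "a > 0" "b > 0" "c > 0" and Y: "x \<in> Y" "y \<in> Y" "z \<in> Y"
    using assms by (auto simp: inf_cone_def)
  define D where "D = diameter Y"
  define m where "m = min a c"
  have tri: "dist x z \<le> dist x y + dist y z"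
    by (rule dist_triangle)
  have bd: "dist x z \<le> D"
    unfolding D_def using assms(1) Y by (intro diameter_bounded_bound)
  then have D0: "0 \<le> D"
    by (meson zero_le_dist order_trans)
  have "\<bar>a - c\<bar> * D + m * dist x z \<le>
      \<bar>a - b\<bar> * D + min a b * dist x y + (\<bar>b - c\<bar> * D + min b c * dist y z)"
  proof (cases "m \<le> b")
    case True
    have "\<bar>a - c\<bar> * D \<le> (\<bar>a - b\<bar> + \<bar>b - c\<bar>) * D"
      using D0 by (intro mult_right_mono) auto
    moreover have "m * dist x z \<le> m * dist x y + m * dist y z"
      using tri pos by (simp add: m_def flip: distrib_left)
    moreover have "m * dist x y \<le> min a b * dist x y" "m * dist y z \<le> min b c * dist y z"
      using True by (auto simp: m_def intro!: mult_right_mono)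
    ultimately show ?thesis
      by (simp add: distrib_right)
  next
    case False
    then have min: "min a b = b" "min b c = b"
      by (auto simp: m_def)
    have "\<bar>a - b\<bar> + \<bar>b - c\<bar> = \<bar>a - c\<bar> + 2 * (m - b)"
      using False by (auto simp: m_def)
    then have "\<bar>a - b\<bar> * D + \<bar>b - c\<bar> * D = \<bar>a - c\<bar> * D + 2 * ((m - b) * D)"
      by (metis distrib_right mult.assoc)
    moreover have "m * dist x z = b * dist x z + (m - b) * dist x z"
      by (simp add: algebra_simps)
    moreover have "b * dist x z \<le> b * dist x y + b * dist y z"
      using tri pos by (simp flip: distrib_left)
    moreover have "(m - b) * dist x z \<le> (m - b) * D" "0 \<le> (m - b) * D"
      using False bd D0 by (auto intro!: mult_left_mono)
    ultimately show ?thesis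
      unfolding min by linarith
  qed
  then show ?thesis
    by (simp add: pqr cone_dist_def D_def m_def)
qed

lemma warped_admissible_exists:
  fixes Y :: "'y::metric_space set"
  assumes "bounded Y" "0 < diameter Y"
  shows "\<exists>\<delta>. warped_admissible Y \<phi> S \<delta>"
proof -
  define \<delta> where
    "\<delta> p q = (if p \<in> inf_cone Y \<and> q \<in> inf_cone Y then min 1 (cone_dist Y p q) else 0)" for p q
  have nn: "0 \<le> cone_dist Y p q" if "p \<in> inf_cone Y" "q \<in> inf_cone Y" for p q
    using that assms(2) by (auto simp: cone_dist_def inf_cone_def)
  have z: "cone_dist Y p q = 0 \<longleftrightarrow> p = q" if "p \<in> inf_cone Y" "q \<in> inf_cone Y" for p q
  proof -
    have "0 \<le> \<bar>fst p - fst q\<bar> * diameter Y" "0 \<le> min (fst p) (fst q) * dist (snd p) (snd q)"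
      "min (fst p) (fst q) \<noteq> 0"
      using that assms(2) by (auto simp: inf_cone_def)
    then show ?thesis
      using assms(2) by (auto simp: cone_dist_def add_nonneg_eq_0_iff prod_eq_iff)
  qed
  have "Metric_space (inf_cone Y) \<delta>"
  proof
    show "0 \<le> \<delta> p q" for p q
      using nn by (auto simp: \<delta>_def)
    show "\<delta> p q = \<delta> q p" for p q
      by (auto simp: \<delta>_def cone_dist_def dist_commute min.commute abs_minus_commute)
    show "\<delta> p q = 0 \<longleftrightarrow> p = q" if "p \<in> inf_cone Y" "q \<in> inf_cone Y" for p q
      using z[OF that] that by (auto simp: \<delta>_def min_def)
    show "\<delta> p r \<le> \<delta> p q + \<delta> q r" if "p \<in> inf_cone Y" "q \<in> inf_cone Y" "r \<in> inf_cone Y" for p q r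
      using cone_dist_triangle[OF assms(1) that] nn that by (auto simp: \<delta>_def min_def)
        (smt (verit) nn)+
  qed
  moreover have "\<delta> p q \<le> 1" for p q
    by (simp add: \<delta>_def)
  ultimately have "warped_admissible Y \<phi> S \<delta>"
    by (simp add: warped_admissible_def) (simp add: \<delta>_def)
  then show ?thesis
    by blast
qed

lemma warped_dist_greatest:
  assumes "warped_admissible Y \<phi> S \<delta>" "p \<in> inf_cone Y" "q \<in> inf_cone Y"
  shows "\<delta> p q \<le> warped_dist Y \<phi> S p q"
proof -
  have "bdd_above ((\<lambda>\<delta>. \<delta> p q) ` {\<delta>. warped_admissible Y \<phi> S \<delta>})"
    using assms(2,3) by (intro bdd_aboveI[of _ "cone_dist Y p q"]) (auto simp: warped_admissible_def)
  then have "\<delta> p q \<le> (SUP \<delta>\<in>{\<delta>. warped_admissible Y \<phi> S \<delta>}. \<delta> p q)"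
    by (rule cSUP_upper2) (use assms(1) in auto)
  then show ?thesis
    using assms by (simp add: warped_dist_def)
qed

lemma warped_dist_least:
  assumes "bounded Y" "0 < diameter Y" "p \<in> inf_cone Y" "q \<in> inf_cone Y"
    and "\<And>\<delta>. warped_admissible Y \<phi> S \<delta> \<Longrightarrow> \<delta> p q \<le> c"
  shows "warped_dist Y \<phi> S p q \<le> c"
  using assms warped_admissible_exists[OF assms(1,2), of \<phi> S]
  by (auto simp: warped_dist_def intro!: cSUP_least)

lemma warped_dist_admissible:
  fixes Y :: "'y::metric_space set"
  assumes Y: "bounded Y" "0 < diameter Y"
    and inv: "\<And>s y. s \<in> S \<Longrightarrow> y \<in> Y \<Longrightarrow> \<phi> s y \<in> Y"
  shows "warped_admissible Y \<phi> S (warped_dist Y \<phi> S)"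
proof -
  let ?w = "warped_dist Y \<phi> S"
  obtain \<delta>0 where \<delta>0: "warped_admissible Y \<phi> S \<delta>0"
    using warped_admissible_exists[OF Y] by blast
  then interpret \<delta>0: Metric_space "inf_cone Y" \<delta>0
    by (simp add: warped_admissible_def)
  have "Metric_space (inf_cone Y) ?w"
  proof
    show "0 \<le> ?w p q" for p q
    proof (cases "p \<in> inf_cone Y \<and> q \<in> inf_cone Y")
      case True
      then show ?thesis
        using warped_dist_greatest[OF \<delta>0] \<delta>0.nonneg by (meson order_trans)
    qed (auto simp: warped_dist_def)
    have "\<delta> p q = \<delta> q p" if "warped_admissible Y \<phi> S \<delta>" for \<delta> p q
      using that by (simp add: warped_admissible_def Metric_space.commute[of "inf_cone Y"])
    then show "?w p q = ?w q p" for p q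
      by (auto simp: warped_dist_def intro!: SUP_cong)
    show "?w p q = 0 \<longleftrightarrow> p = q" if pq: "p \<in> inf_cone Y" "q \<in> inf_cone Y" for p q
    proof
      assume "?w p q = 0"
      then have "\<delta>0 p q \<le> 0"
        using warped_dist_greatest[OF \<delta>0 pq] by simp
      then have "\<delta>0 p q = 0"
        using \<delta>0.nonneg by (simp add: order_antisym)
      then show "p = q"
        using pq by simp
    next
      assume eq: "p = q"
      have "?w p q \<le> 0"
        using pq by (intro warped_dist_least[OF Y])
          (auto simp: eq warped_admissible_def Metric_space.mdist_zero)
      then show "?w p q = 0"
        using \<open>0 \<le> ?w p q\<close> by simp
    qed
    show "?w p r \<le> ?w p q + ?w q r"
      if pqr: "p \<in> inf_cone Y" "q \<in> inf_cone Y" "r \<in> inf_cone Y" for p q r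
    proof (rule warped_dist_least[OF Y pqr(1,3)])
      fix \<delta> assume \<delta>: "warped_admissible Y \<phi> S \<delta>"
      then have "\<delta> p r \<le> \<delta> p q + \<delta> q r"
        using pqr by (auto simp: warped_admissible_def intro: Metric_space.triangle)
      also have "\<dots> \<le> ?w p q + ?w q r"
        using warped_dist_greatest[OF \<delta>] pqr by (intro add_mono) auto
      finally show "\<delta> p r \<le> ?w p q + ?w q r" .
    qed
  qed
  moreover have "?w p q \<le> cone_dist Y p q" if "p \<in> inf_cone Y" "q \<in> inf_cone Y" for p q
    using that by (intro warped_dist_least[OF Y]) (auto simp: warped_admissible_def)
  moreover have "?w p (cone_action \<phi> s p) \<le> 1" if "p \<in> inf_cone Y" "s \<in> S" for p s
  proof (rule warped_dist_least[OF Y that(1)])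
    show "cone_action \<phi> s p \<in> inf_cone Y"
      using that inv by (auto simp: cone_action_def inf_cone_def)
  qed (use that in \<open>auto simp: warped_admissible_def\<close>)
  ultimately show ?thesis
    by (simp add: warped_admissible_def)
qed

end

theory Submission
  imports Defs
begin

text \<open>
  Property A attaches to every point of the warped cone a probability measure of bounded support,
  almost invariantly under bounded displacements. On a sufficiently high level \<open>{r} \<times> Y\<close> the cone
  metric is so expanded that a warped ball of fixed radius \<open>N\<close> around \<open>(r, y)\<close> consists of points
  whose base coordinate is close to \<open>F y\<close>, for a finite set \<open>F\<close> of group elements depending only on
  \<open>N\<close> (\<open>warped_ball_near_orbit\<close>). Freeness and compactness keep the finitely many translates \<open>g y\<close>
  uniformly apart, so a point near \<open>F y\<close> can be labelled by the \<open>g\<close> it is close to. Pushing the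
  measure at \<open>(r, y)\<close> forward along this labelling gives a measure \<open>D y\<close> on the group. Labels
  relative to \<open>y\<close> and to \<open>\<gamma> y\<close> differ by right translation by \<open>\<gamma>\<^sup>-\<^sup>1\<close>, and \<open>(r, y)\<close>, \<open>(r, \<gamma> y)\<close> have
  bounded warped distance, so \<open>D\<close> is almost equivariant (\<open>almost_equivariant_measures\<close>).

  The maps of property A need not be continuous, but the almost equivariance of \<open>D\<close> tolerates a
  small error in the base point. Averaging \<open>D\<close> over a fine net with a partition of unity therefore
  gives a continuous family with the same bound (\<open>continuous_average\<close>).

  The inclusion of warped balls requires lower bounds for the warped metric. It is the largest
  admissible metric, so the differences of any real function that is \<open>1\<close>-Lipschitz for the cone metric
  and changes by at most \<open>1\<close> under generators bound it from below (\<open>wd_ge_test_function\<close>). A suitable function is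
  built from the least cost of reaching \<open>y\<close> by a group element followed by a small jump
  (\<open>orbit_cost\<close>). That function is only equicontinuous; after regularization it becomes Lipschitz
  with a constant independent of \<open>y\<close>, which on a high level is good enough.
\<close>

section \<open>Total variation\<close>

lemma tv_dist_leI:
  assumes "space M \<noteq> {}"
    and "\<And>P. finite P \<Longrightarrow> P \<subseteq> sets M \<Longrightarrow> partition_on (space M) P \<Longrightarrow>
           (\<Sum>A\<in>P. \<bar>measure M A - measure N A\<bar>) \<le> c"
  shows "tv_dist M N \<le> c"
  unfolding tv_dist_def
proof (rule cSUP_least)
  have "{space M} \<in> {P. finite P \<and> P \<subseteq> sets M \<and> partition_on (space M) P}"
    using assms(1) by (auto intro: partition_on_space)
  then show "{P. finite P \<and> P \<subseteq> sets M \<and> partition_on (space M) P} \<noteq> {}"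
    by blast
qed (use assms(2) in auto)

lemma sum_partition_le_tv_dist:
  assumes "prob_space M" "prob_space N" "sets N = sets M"
    and "finite P" "P \<subseteq> sets M" "partition_on (space M) P"
  shows "(\<Sum>A\<in>P. \<bar>measure M A - measure N A\<bar>) \<le> tv_dist M N"
  unfolding tv_dist_def
proof (rule cSUP_upper)
  show "bdd_above ((\<lambda>P. \<Sum>A\<in>P. \<bar>measure M A - measure N A\<bar>) `
      {P. finite P \<and> P \<subseteq> sets M \<and> partition_on (space M) P})"
    using tv_sum_le_2[OF assms(1-3)] by (intro bdd_aboveI[of _ 2]) auto
qed (use assms in auto)

lemma tv_dist_nonneg:
  assumes "prob_space M" "prob_space N" "sets N = sets M"
  shows "0 \<le> tv_dist M N"
proof -
  interpret prob_space M by fact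
  have "0 \<le> (\<Sum>A\<in>{space M}. \<bar>measure M A - measure N A\<bar>)"
    by simp
  also have "\<dots> \<le> tv_dist M N"
    using not_empty by (intro sum_partition_le_tv_dist[OF assms]) (auto intro: partition_on_space)
  finally show ?thesis .
qed

text \<open>
  A partition of the target pulls back to a partition of the source, once the empty preimages
  (which contribute nothing) are discarded.
\<close>

lemma tv_dist_distr_le:
  assumes "prob_space M" "prob_space N" "sets N = sets M" and f: "f \<in> measurable M K"
  shows "tv_dist (distr M K f) (distr N K f) \<le> tv_dist M N"
proof (rule tv_dist_leI)
  interpret prob_space M by fact
  have sp: "space N = space M"
    using sets_eq_imp_space_eq[OF assms(3)] .
  have fN: "f \<in> measurable N K"
    using f by (simp add: measurable_cong_sets[OF assms(3) refl])
  show "space (distr M K f) \<noteq> {}"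
    using not_empty measurable_space[OF f] by auto
  fix P assume P: "finite P" "P \<subseteq> sets (distr M K f)" "partition_on (space (distr M K f)) P"
  define pre where "pre A = f -` A \<inter> space M" for A
  define P' where "P' = {A\<in>P. pre A \<noteq> {}}"
  have disj: "A = B" if "A \<in> P" "B \<in> P" "x \<in> A" "x \<in> B" for A B x
    using P(3) that unfolding partition_on_def disjoint_def by blast
  have inj: "inj_on pre P'"
  proof (rule inj_onI)
    fix A B assume AB: "A \<in> P'" "B \<in> P'" "pre A = pre B"
    then obtain x where "f x \<in> A" "f x \<in> B"
      by (auto simp: P'_def pre_def)
    then show "A = B"
      using AB disj by (auto simp: P'_def)
  qed
  have part: "partition_on (space M) (pre ` P')"
  proof (rule partition_onI)
    have "x \<in> \<Union> (pre ` P')" if "x \<in> space M" for x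
    proof -
      have "f x \<in> \<Union> P"
        using P(3) measurable_space[OF f that] by (auto simp: partition_on_def)
      then show ?thesis
        using that by (auto simp: P'_def pre_def)
    qed
    then show "\<Union> (pre ` P') = space M"
      by (auto simp: pre_def)
    show "disjnt p q" if "p \<in> pre ` P'" "q \<in> pre ` P'" "p \<noteq> q" for p q
      using that disj unfolding disjnt_def P'_def pre_def by blast
    show "{} \<notin> pre ` P'"
      by (auto simp: P'_def)
  qed
  have "(\<Sum>A\<in>P. \<bar>measure (distr M K f) A - measure (distr N K f) A\<bar>)
      = (\<Sum>A\<in>P. \<bar>measure M (pre A) - measure N (pre A)\<bar>)"
    using P(2) f fN by (intro sum.cong) (auto simp: measure_distr pre_def sp)
  also have "\<dots> = (\<Sum>A\<in>P'. \<bar>measure M (pre A) - measure N (pre A)\<bar>)"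
    using P(1) by (intro sum.mono_neutral_right) (auto simp: P'_def)
  also have "\<dots> = (\<Sum>B\<in>pre ` P'. \<bar>measure M B - measure N B\<bar>)"
    using inj by (simp add: sum.reindex)
  also have "\<dots> \<le> tv_dist M N"
  proof (rule sum_partition_le_tv_dist[OF assms(1-3) _ _ part])
    show "finite (pre ` P')"
      using P(1) by (simp add: P'_def)
    show "pre ` P' \<subseteq> sets M"
      using P(2) f by (auto simp: P'_def pre_def)
  qed
  finally show "(\<Sum>A\<in>P. \<bar>measure (distr M K f) A - measure (distr N K f) A\<bar>) \<le> tv_dist M N" .
qed

section \<open>Finite mixtures of probability measures\<close>

definition mixture :: "'i set \<Rightarrow> ('i \<Rightarrow> real) \<Rightarrow> ('i \<Rightarrow> 'a measure) \<Rightarrow> 'a measure" where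
  "mixture I w D = point_measure I (\<lambda>i. ennreal (w i)) \<bind> D"

definition convex_weights :: "'i set \<Rightarrow> ('i \<Rightarrow> real) \<Rightarrow> bool" where
  "convex_weights I w \<longleftrightarrow> finite I \<and> (\<forall>i\<in>I. 0 \<le> w i) \<and> sum w I = 1"

lemma
  assumes w: "convex_weights I w" and D: "\<And>i. i \<in> I \<Longrightarrow> D i \<in> space (prob_algebra K)"
  shows mixture_in_prob_algebra: "mixture I w D \<in> space (prob_algebra K)"
    and measure_mixture:
      "Z \<in> sets K \<Longrightarrow> measure (mixture I w D) Z = (\<Sum>i\<in>I. w i * measure (D i) Z)"
proof -
  let ?P = "point_measure I (\<lambda>i. ennreal (w i))"
  have fin: "finite I" and nn: "\<And>i. i \<in> I \<Longrightarrow> 0 \<le> w i" and one: "sum w I = 1"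
    using w by (auto simp: convex_weights_def)
  have "emeasure ?P I = 1"
    using fin nn one by (simp add: emeasure_point_measure_finite sum_ennreal)
  then have P: "?P \<in> space (prob_algebra (count_space I))"
    by (auto simp: space_prob_algebra space_point_measure sets_point_measure intro!: prob_spaceI)
  have D': "D \<in> count_space I \<rightarrow>\<^sub>M prob_algebra K"
    using D by auto
  show "mixture I w D \<in> space (prob_algebra K)"
    using sets_bind'[OF P D'] prob_space_bind'[OF P D'] by (simp add: mixture_def space_prob_algebra)
  assume Z: "Z \<in> sets K"
  have "emeasure (mixture I w D) Z = (\<Sum>i\<in>I. ennreal (w i) * emeasure (D i) Z)"
    unfolding mixture_def emeasure_bind_prob_algebra[OF P D' Z]
    by (rule nn_integral_point_measure_finite[OF fin])
  also have "\<dots> = (\<Sum>i\<in>I. ennreal (w i * measure (D i) Z))"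
  proof (rule sum.cong[OF refl])
    fix i assume i: "i \<in> I"
    then interpret prob_space "D i"
      using D by (simp add: space_prob_algebra)
    show "ennreal (w i) * emeasure (D i) Z = ennreal (w i * measure (D i) Z)"
      using nn[OF i] by (simp add: emeasure_eq_measure ennreal_mult)
  qed
  also have "\<dots> = ennreal (\<Sum>i\<in>I. w i * measure (D i) Z)"
    using nn by (intro sum_ennreal) auto
  finally show "measure (mixture I w D) Z = (\<Sum>i\<in>I. w i * measure (D i) Z)"
    using nn by (simp add: measure_def sum_nonneg)
qed

lemma distr_mixture:
  assumes w: "convex_weights I w" and D: "\<And>i. i \<in> I \<Longrightarrow> D i \<in> space (prob_algebra K)"
    and f: "f \<in> measurable K L"
  shows "distr (mixture I w D) L f = mixture I w (\<lambda>i. distr (D i) L f)"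
proof (rule measure_eqI)
  have mix: "mixture I w D \<in> space (prob_algebra K)"
    by (rule mixture_in_prob_algebra[OF w D])
  have measf: "f \<in> measurable M L" if "M \<in> space (prob_algebra K)" for M
    using that f by (auto simp: space_prob_algebra cong: measurable_cong_sets)
  have spD: "space M = space K" if "M \<in> space (prob_algebra K)" for M
    using that sets_eq_imp_space_eq by (auto simp: space_prob_algebra)
  have fD: "distr M L f \<in> space (prob_algebra L)" if "M \<in> space (prob_algebra K)" for M
    using that measf[OF that] by (auto simp: space_prob_algebra intro: prob_space.prob_space_distr)
  have mix': "mixture I w (\<lambda>i. distr (D i) L f) \<in> space (prob_algebra L)"
    by (intro mixture_in_prob_algebra[OF w] fD D)
  then show "sets (distr (mixture I w D) L f) = sets (mixture I w (\<lambda>i. distr (D i) L f))"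
    by (simp add: space_prob_algebra)
  fix Z assume "Z \<in> sets (distr (mixture I w D) L f)"
  then have Z: "Z \<in> sets L"
    by simp
  interpret A: prob_space "distr (mixture I w D) L f"
    using fD[OF mix] by (simp add: space_prob_algebra)
  interpret B: prob_space "mixture I w (\<lambda>i. distr (D i) L f)"
    using mix' by (simp add: space_prob_algebra)
  have "measure (distr (mixture I w D) L f) Z = measure (mixture I w D) (f -` Z \<inter> space K)"
    using measf[OF mix] Z by (simp add: measure_distr spD[OF mix])
  also have "\<dots> = (\<Sum>i\<in>I. w i * measure (D i) (f -` Z \<inter> space K))"
    using measure_mixture[OF w D measurable_sets[OF f Z]] by simp
  also have "\<dots> = (\<Sum>i\<in>I. w i * measure (distr (D i) L f) Z)"
    using Z by (intro sum.cong) (simp_all add: measure_distr measf D spD)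
  also have "\<dots> = measure (mixture I w (\<lambda>i. distr (D i) L f)) Z"
    by (rule measure_mixture[OF w fD[OF D] Z, symmetric])
  finally show "emeasure (distr (mixture I w D) L f) Z
      = emeasure (mixture I w (\<lambda>i. distr (D i) L f)) Z"
    by (simp add: A.emeasure_eq_measure B.emeasure_eq_measure)
qed

text \<open>
  Expanding both mixtures over the product weights \<open>w i * v j\<close> turns the difference into a convex
  combination of differences of components; only pairs of positive weight matter.
\<close>

lemma tv_dist_mixture_le:
  assumes w: "convex_weights I w" and v: "convex_weights J v"
    and D: "\<And>i. i \<in> I \<Longrightarrow> D i \<in> space (prob_algebra K)"
    and E: "\<And>j. j \<in> J \<Longrightarrow> E j \<in> space (prob_algebra K)"
    and c: "\<And>i j. i \<in> I \<Longrightarrow> j \<in> J \<Longrightarrow> 0 < w i \<Longrightarrow> 0 < v j \<Longrightarrow> tv_dist (D i) (E j) \<le> c"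
  shows "tv_dist (mixture I w D) (mixture J v E) \<le> c"
proof (rule tv_dist_leI)
  let ?M = "mixture I w D" and ?N = "mixture J v E"
  have w': "\<And>i. i \<in> I \<Longrightarrow> 0 \<le> w i" "sum w I = 1" and v': "\<And>j. j \<in> J \<Longrightarrow> 0 \<le> v j" "sum v J = 1"
    using w v by (auto simp: convex_weights_def)
  have M: "?M \<in> space (prob_algebra K)"
    by (rule mixture_in_prob_algebra[OF w D])
  then interpret prob_space ?M
    by (simp add: space_prob_algebra)
  show "space ?M \<noteq> {}"
    by (rule not_empty)
  fix P assume P: "finite P" "P \<subseteq> sets ?M" "partition_on (space ?M) P"
  have sK: "sets ?M = sets K" "space ?M = space K"
    using M sets_eq_imp_space_eq by (auto simp: space_prob_algebra)
  have eq: "measure ?M A - measure ?N A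
      = (\<Sum>i\<in>I. \<Sum>j\<in>J. w i * v j * (measure (D i) A - measure (E j) A))" if "A \<in> P" for A
  proof -
    have A: "A \<in> sets K"
      using that P(2) sK by auto
    have "(\<Sum>i\<in>I. \<Sum>j\<in>J. w i * v j * (measure (D i) A - measure (E j) A))
        = (\<Sum>i\<in>I. \<Sum>j\<in>J. v j * (w i * measure (D i) A)) - (\<Sum>i\<in>I. \<Sum>j\<in>J. w i * (v j * measure (E j) A))"
      by (simp add: algebra_simps sum_subtractf)
    also have "\<dots> = sum v J * (\<Sum>i\<in>I. w i * measure (D i) A) - sum w I * (\<Sum>j\<in>J. v j * measure (E j) A)"
      by (simp only: sum_product sum.swap[of _ J I])
    finally show ?thesis
      using measure_mixture[OF w D A] measure_mixture[OF v E A] w'(2) v'(2) by simp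
  qed
  have pair: "w i * v j * (\<Sum>A\<in>P. \<bar>measure (D i) A - measure (E j) A\<bar>) \<le> w i * v j * c"
    if ij: "i \<in> I" "j \<in> J" for i j
  proof (cases "0 < w i \<and> 0 < v j")
    case True
    have sD: "sets (D i) = sets K" "space (D i) = space K" "sets (E j) = sets K"
      "prob_space (D i)" "prob_space (E j)"
      using D[OF ij(1)] E[OF ij(2)] sets_eq_imp_space_eq by (auto simp: space_prob_algebra)
    have "(\<Sum>A\<in>P. \<bar>measure (D i) A - measure (E j) A\<bar>) \<le> tv_dist (D i) (E j)"
      using P sK sD by (intro sum_partition_le_tv_dist) auto
    also have "\<dots> \<le> c"
      using c ij True by blast
    finally show ?thesis
      using True by (intro mult_left_mono) auto
  next
    case False
    then have "w i * v j = 0"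
      using w'(1)[OF ij(1)] v'(1)[OF ij(2)] by auto
    then show ?thesis
      by (simp only: mult_zero_left order_refl)
  qed
  have "(\<Sum>A\<in>P. \<bar>measure ?M A - measure ?N A\<bar>)
      \<le> (\<Sum>A\<in>P. \<Sum>i\<in>I. \<Sum>j\<in>J. w i * v j * \<bar>measure (D i) A - measure (E j) A\<bar>)"
  proof (rule sum_mono)
    fix A assume "A \<in> P"
    have "\<bar>\<Sum>i\<in>I. \<Sum>j\<in>J. w i * v j * (measure (D i) A - measure (E j) A)\<bar>
        \<le> (\<Sum>i\<in>I. \<Sum>j\<in>J. \<bar>w i * v j * (measure (D i) A - measure (E j) A)\<bar>)"
      by (intro order_trans[OF sum_abs] sum_mono sum_abs)
    also have "\<dots> = (\<Sum>i\<in>I. \<Sum>j\<in>J. w i * v j * \<bar>measure (D i) A - measure (E j) A\<bar>)"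
      using w'(1) v'(1) by (intro sum.cong refl) (simp add: abs_mult)
    finally show "\<bar>measure ?M A - measure ?N A\<bar>
        \<le> (\<Sum>i\<in>I. \<Sum>j\<in>J. w i * v j * \<bar>measure (D i) A - measure (E j) A\<bar>)"
      by (simp only: eq[OF \<open>A \<in> P\<close>])
  qed
  also have "\<dots> = (\<Sum>i\<in>I. \<Sum>j\<in>J. w i * v j * (\<Sum>A\<in>P. \<bar>measure (D i) A - measure (E j) A\<bar>))"
    by (simp only: sum.swap[of _ _ P] sum_distrib_left)
  also have "\<dots> \<le> (\<Sum>i\<in>I. \<Sum>j\<in>J. w i * v j * c)"
    by (intro sum_mono pair)
  also have "\<dots> = sum w I * sum v J * c"
    by (subst sum_product) (simp only: sum_distrib_right)
  finally show "(\<Sum>A\<in>P. \<bar>measure ?M A - measure ?N A\<bar>) \<le> c"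
    using w'(2) v'(2) by simp
qed

lemma tv_dist_mixture_weights_le:
  assumes w: "convex_weights I w" and v: "convex_weights I v"
    and D: "\<And>i. i \<in> I \<Longrightarrow> D i \<in> space (prob_algebra K)"
  shows "tv_dist (mixture I w D) (mixture I v D) \<le> (\<Sum>i\<in>I. \<bar>w i - v i\<bar>)"
proof (rule tv_dist_leI)
  let ?M = "mixture I w D" and ?N = "mixture I v D"
  have M: "?M \<in> space (prob_algebra K)"
    by (rule mixture_in_prob_algebra[OF w D])
  then interpret prob_space ?M
    by (simp add: space_prob_algebra)
  show "space ?M \<noteq> {}"
    by (rule not_empty)
  have sK: "sets ?M = sets K" "space ?M = space K"
    using M sets_eq_imp_space_eq by (auto simp: space_prob_algebra)
  fix P assume P: "finite P" "P \<subseteq> sets ?M" "partition_on (space ?M) P"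
  have one: "(\<Sum>A\<in>P. measure (D i) A) = 1" if i: "i \<in> I" for i
  proof (rule prob_sum_partition[OF _ P(1)])
    show "prob_space (D i)" "P \<subseteq> sets (D i)" "partition_on (space (D i)) P"
      using D[OF i] P sK sets_eq_imp_space_eq[of "D i" K] by (auto simp: space_prob_algebra)
  qed
  have "(\<Sum>A\<in>P. \<bar>measure ?M A - measure ?N A\<bar>) \<le> (\<Sum>A\<in>P. \<Sum>i\<in>I. \<bar>w i - v i\<bar> * measure (D i) A)"
  proof (rule sum_mono)
    fix A assume "A \<in> P"
    then have A: "A \<in> sets K"
      using P(2) sK by auto
    have "measure ?M A - measure ?N A = (\<Sum>i\<in>I. (w i - v i) * measure (D i) A)"
      by (simp add: measure_mixture[OF w D A] measure_mixture[OF v D A] sum_subtractf algebra_simps)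
    also have "\<bar>\<dots>\<bar> \<le> (\<Sum>i\<in>I. \<bar>(w i - v i) * measure (D i) A\<bar>)"
      by (rule sum_abs)
    finally show "\<bar>measure ?M A - measure ?N A\<bar> \<le> (\<Sum>i\<in>I. \<bar>w i - v i\<bar> * measure (D i) A)"
      by (simp add: abs_mult)
  qed
  also have "\<dots> = (\<Sum>i\<in>I. \<bar>w i - v i\<bar> * (\<Sum>A\<in>P. measure (D i) A))"
    by (simp only: sum.swap[of _ _ P] sum_distrib_left)
  finally show "(\<Sum>A\<in>P. \<bar>measure ?M A - measure ?N A\<bar>) \<le> (\<Sum>i\<in>I. \<bar>w i - v i\<bar>)"
    using one by simp
qed

section \<open>Word balls and uniform estimates for the action\<close>

text \<open>
  Inverses are included because generation as a group does not require \<open>S\<close> to be symmetric. Words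
  grow on the right, where the next letter is the first to act on a point.
\<close>

primrec word_ball :: "('g, 'b) monoid_scheme \<Rightarrow> 'g set \<Rightarrow> nat \<Rightarrow> 'g set" where
  "word_ball G S 0 = {\<one>\<^bsub>G\<^esub>}"
| "word_ball G S (Suc k) = word_ball G S k \<union>
     (\<Union>g\<in>word_ball G S k. \<Union>s\<in>S. {g \<otimes>\<^bsub>G\<^esub> s, g \<otimes>\<^bsub>G\<^esub> inv\<^bsub>G\<^esub> s})"

lemma finite_word_ball: "finite S \<Longrightarrow> finite (word_ball G S k)"
  by (induction k) auto

lemma one_in_word_ball: "\<one>\<^bsub>G\<^esub> \<in> word_ball G S k"
  by (induction k) auto

lemma word_ball_mono: "k \<le> l \<Longrightarrow> word_ball G S k \<subseteq> word_ball G S l"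
  by (induction l) (auto simp: le_Suc_eq)

context group
begin

lemma word_ball_subset_carrier: "S \<subseteq> carrier G \<Longrightarrow> word_ball G S k \<subseteq> carrier G"
  by (induction k) auto

lemma word_ball_mult:
  assumes S: "S \<subseteq> carrier G" and g: "g \<in> word_ball G S k" and h: "h \<in> word_ball G S l"
  shows "g \<otimes> h \<in> word_ball G S (k + l)"
  using h
proof (induction l arbitrary: h)
  case 0
  then show ?case
    using g subsetD[OF word_ball_subset_carrier[OF S] g] by simp
next
  case (Suc l)
  have gG: "g \<in> carrier G"
    using g word_ball_subset_carrier[OF S] by blast
  from Suc.prems consider "h \<in> word_ball G S l"
    | u s where "u \<in> word_ball G S l" "s \<in> S" "h = u \<otimes> s \<or> h = u \<otimes> inv s"
    by auto
  then show ?case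
  proof cases
    case 1
    then show ?thesis
      using Suc.IH by auto
  next
    case 2
    moreover have "u \<in> carrier G" "s \<in> carrier G"
      using 2 S word_ball_subset_carrier[OF S] by auto
    ultimately have "g \<otimes> h = g \<otimes> u \<otimes> s \<or> g \<otimes> h = g \<otimes> u \<otimes> inv s"
      using gG by (auto simp: m_assoc)
    then show ?thesis
      using Suc.IH[OF \<open>u \<in> word_ball G S l\<close>] \<open>s \<in> S\<close> by auto
  qed
qed

lemma generate_subset_word_balls:
  assumes S: "S \<subseteq> carrier G"
  shows "generate G S \<subseteq> (\<Union>k. word_ball G S k)"
proof
  fix g assume "g \<in> generate G S"
  then show "g \<in> (\<Union>k. word_ball G S k)"
  proof (induction rule: generate.induct)
    case one
    then show ?case
      using one_in_word_ball by blast
  next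
    case (incl s)
    then have "s = \<one> \<otimes> s"
      using S by auto
    then have "s \<in> word_ball G S (Suc 0)"
      using incl by auto
    then show ?case
      by blast
  next
    case (inv s)
    then have "inv s = \<one> \<otimes> inv s"
      using S by auto
    then have "inv s \<in> word_ball G S (Suc 0)"
      using inv by auto
    then show ?case
      by blast
  next
    case (eng g h)
    then show ?case
      using word_ball_mult[OF S] by blast
  qed
qed

end

locale compact_action = group G for G :: "('g, 'b) monoid_scheme" (structure) +
  fixes S and Y :: "'y::metric_space set" and \<phi> :: "'g \<Rightarrow> 'y \<Rightarrow> 'y"
  assumes finite_S: "finite S" and S_subset: "S \<subseteq> carrier G"
    and compact_Y: "compact Y" and diameter_pos: "0 < diameter Y"
    and acts: "acts_continuously G Y \<phi>"
begin

lemma group_action: "group_action G Y \<phi>"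
  using acts by (simp add: acts_continuously_def)

lemma bounded_Y: "bounded Y"
  using compact_Y by (rule compact_imp_bounded)

lemma Y_nonempty: "Y \<noteq> {}"
  using diameter_pos by auto

lemma act_closed: "g \<in> carrier G \<Longrightarrow> y \<in> Y \<Longrightarrow> \<phi> g y \<in> Y"
  using group_action.element_image[OF group_action] by blast

lemma act_mult: "g \<in> carrier G \<Longrightarrow> h \<in> carrier G \<Longrightarrow> y \<in> Y \<Longrightarrow> \<phi> (g \<otimes> h) y = \<phi> g (\<phi> h y)"
  using group_action.composition_rule[OF group_action] by blast

lemma act_one: "y \<in> Y \<Longrightarrow> \<phi> \<one> y = y"
  using group_action.id_eq_one[OF group_action] by (metis restrict_apply')

lemma act_inv: "g \<in> carrier G \<Longrightarrow> y \<in> Y \<Longrightarrow> \<phi> (inv g) (\<phi> g y) = y"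
  using group_action.orbit_sym_aux[OF group_action] by blast

lemma act_inv': "g \<in> carrier G \<Longrightarrow> y \<in> Y \<Longrightarrow> \<phi> g (\<phi> (inv g) y) = y"
  using act_inv[of "inv g" y] by simp

lemma continuous_act: "g \<in> carrier G \<Longrightarrow> continuous_on Y (\<phi> g)"
  using acts by (simp add: acts_continuously_def)

lemma uniform_modulus:
  assumes "finite F" "F \<subseteq> carrier G" "0 < e"
  shows "\<exists>d>0. \<forall>g\<in>F. \<forall>x\<in>Y. \<forall>y\<in>Y. dist x y < d \<longrightarrow> dist (\<phi> g x) (\<phi> g y) < e"
  using assms(1,2)
proof (induction F)
  case empty
  then show ?case
    by (auto intro: exI[of _ 1])
next
  case (insert g F)
  then obtain d where d: "0 < d" "\<forall>g\<in>F. \<forall>x\<in>Y. \<forall>y\<in>Y. dist x y < d \<longrightarrow> dist (\<phi> g x) (\<phi> g y) < e"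
    by auto
  have "uniformly_continuous_on Y (\<phi> g)"
    using insert.prems compact_Y continuous_act by (intro compact_uniformly_continuous) auto
  then obtain d' where d': "0 < d'" "\<forall>x\<in>Y. \<forall>y\<in>Y. dist x y < d' \<longrightarrow> dist (\<phi> g x) (\<phi> g y) < e"
    using \<open>0 < e\<close> unfolding uniformly_continuous_on_def by (metis dist_commute)
  have "\<forall>h\<in>insert g F. \<forall>x\<in>Y. \<forall>y\<in>Y. dist x y < min d d' \<longrightarrow> dist (\<phi> h x) (\<phi> h y) < e"
    using d(2) d'(2) by auto
  then show ?case
    using d(1) d'(1) by (metis min_less_iff_conj)
qed

lemma free_pair_separated:
  assumes free: "acts_freely G Y \<phi>" and g: "g \<in> carrier G" and h: "h \<in> carrier G" and "g \<noteq> h"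
  shows "\<exists>e>0. \<forall>y\<in>Y. e \<le> dist (\<phi> g y) (\<phi> h y)"
proof -
  have "continuous_on Y (\<lambda>y. dist (\<phi> g y) (\<phi> h y))"
    using g h by (intro continuous_intros continuous_act)
  from continuous_attains_inf[OF compact_Y Y_nonempty this]
  obtain y0 where y0: "y0 \<in> Y" "\<forall>y\<in>Y. dist (\<phi> g y0) (\<phi> h y0) \<le> dist (\<phi> g y) (\<phi> h y)"
    by blast
  have "\<phi> g y0 \<noteq> \<phi> h y0"
  proof
    assume "\<phi> g y0 = \<phi> h y0"
    then have "\<phi> (inv h \<otimes> g) y0 = y0"
      using y0 g h by (simp add: act_mult act_inv)
    then have "inv h \<otimes> g = \<one>"
      using free y0 g h by (auto simp: acts_freely_def)
    then show False
      using \<open>g \<noteq> h\<close> g h inv_equality[of "inv h" g] by auto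
  qed
  then show ?thesis
    using y0(2) by (intro exI[of _ "dist (\<phi> g y0) (\<phi> h y0)"]) auto
qed

text \<open>
  This is where freeness enters: on a compact space a free action moves points by a definite
  amount, so finitely many translates of a point stay uniformly apart.
\<close>

lemma free_finite_separated:
  assumes free: "acts_freely G Y \<phi>" and F: "finite F" "F \<subseteq> carrier G"
  shows "\<exists>e>0. \<forall>g\<in>F. \<forall>h\<in>F. g \<noteq> h \<longrightarrow> (\<forall>y\<in>Y. e \<le> dist (\<phi> g y) (\<phi> h y))"
proof -
  define I where "I = {(g, h) \<in> F \<times> F. g \<noteq> h}"
  have "finite I"
    using F by (auto simp: I_def intro: finite_subset[of _ "F \<times> F"])
  have "\<forall>i\<in>I. \<exists>e>0. \<forall>y\<in>Y. e \<le> dist (\<phi> (fst i) y) (\<phi> (snd i) y)"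
    using F free_pair_separated[OF free] by (auto simp: I_def)
  then obtain e where e: "\<And>i. i \<in> I \<Longrightarrow> 0 < e i"
    "\<And>i y. i \<in> I \<Longrightarrow> y \<in> Y \<Longrightarrow> e i \<le> dist (\<phi> (fst i) y) (\<phi> (snd i) y)"
    by metis
  let ?m = "Min (insert 1 (e ` I))"
  have "0 < ?m"
    using \<open>finite I\<close> e(1) by simp
  moreover have "?m \<le> dist (\<phi> g y) (\<phi> h y)" if "g \<in> F" "h \<in> F" "g \<noteq> h" "y \<in> Y" for g h y
  proof -
    have "(g, h) \<in> I"
      using that by (simp add: I_def)
    then have "?m \<le> e (g, h)"
      using \<open>finite I\<close> by (intro Min_le) auto
    then show ?thesis
      using e(2)[OF \<open>(g, h) \<in> I\<close> \<open>y \<in> Y\<close>] by simp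
  qed
  ultimately show ?thesis
    by blast
qed

section \<open>The warped metric\<close>

abbreviation "OY \<equiv> inf_cone Y"
abbreviation "wd \<equiv> warped_dist Y \<phi> S"

lemma warped_admissible_warped_dist: "warped_admissible Y \<phi> S wd"
  using S_subset act_closed by (intro warped_dist_admissible[OF bounded_Y diameter_pos]) auto

sublocale warped: Metric_space OY wd
  using warped_admissible_warped_dist by (simp add: warped_admissible_def)

lemma wd_le_cone_dist: "p \<in> OY \<Longrightarrow> q \<in> OY \<Longrightarrow> wd p q \<le> cone_dist Y p q"
  using warped_admissible_warped_dist by (auto simp: warped_admissible_def)

lemma wd_generator: "p \<in> OY \<Longrightarrow> s \<in> S \<Longrightarrow> wd p (cone_action \<phi> s p) \<le> 1"
  using warped_admissible_warped_dist by (auto simp: warped_admissible_def)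

lemma in_cone: "(r, y) \<in> OY \<longleftrightarrow> 0 < r \<and> y \<in> Y"
  by (simp add: inf_cone_def)

text \<open>
  The warped metric is a supremum, so a lower bound only needs a test function: the maximum of the
  warped metric with the pseudometric \<open>\<bar>u p - u q\<bar>\<close> is again admissible.
\<close>

lemma wd_ge_test_function:
  assumes lip: "\<And>p q. p \<in> OY \<Longrightarrow> q \<in> OY \<Longrightarrow> \<bar>u p - u q\<bar> \<le> cone_dist Y p q"
    and gen: "\<And>p s. p \<in> OY \<Longrightarrow> s \<in> S \<Longrightarrow> \<bar>u p - u (cone_action \<phi> s p)\<bar> \<le> 1"
    and pq: "p \<in> OY" "q \<in> OY"
  shows "\<bar>u p - u q\<bar> \<le> wd p q"
proof -
  define \<delta> where "\<delta> p q = max (wd p q) \<bar>u p - u q\<bar>" for p q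
  have "Metric_space OY \<delta>"
  proof
    show "0 \<le> \<delta> p q" for p q
      by (simp add: \<delta>_def le_max_iff_disj)
    show "\<delta> p q = \<delta> q p" for p q
      by (simp add: \<delta>_def warped.commute abs_minus_commute)
    show "\<delta> p q = 0 \<longleftrightarrow> p = q" if "p \<in> OY" "q \<in> OY" for p q
    proof
      assume "\<delta> p q = 0"
      then have "wd p q \<le> 0"
        by (metis \<delta>_def max.cobounded1)
      then show "p = q"
        using that warped.nonneg[of p q] by (simp add: order_antisym)
    qed (use that in \<open>simp add: \<delta>_def\<close>)
    show "\<delta> p r \<le> \<delta> p q + \<delta> q r" if "p \<in> OY" "q \<in> OY" "r \<in> OY" for p q r
      using warped.triangle[OF that] unfolding \<delta>_def by linarith
  qed
  then have "warped_admissible Y \<phi> S \<delta>"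
    using lip gen wd_le_cone_dist wd_generator by (auto simp: warped_admissible_def \<delta>_def)
  from warped_dist_greatest[OF this pq] show ?thesis
    by (simp add: \<delta>_def)
qed

lemma cone_dist_nonneg: "p \<in> OY \<Longrightarrow> q \<in> OY \<Longrightarrow> 0 \<le> cone_dist Y p q"
  using diameter_pos by (auto simp: cone_dist_def inf_cone_def)

lemma cone_dist_commute: "cone_dist Y p q = cone_dist Y q p"
  by (simp add: cone_dist_def dist_commute min.commute abs_minus_commute)

text \<open>
  Below scale \<open>1\<close> the generators offer no shortcut. Hence the warped metric induces the topology of
  the cone, which makes the sets cut out by the base coordinate measurable.
\<close>

lemma min_cone_dist_le_wd:
  assumes "p \<in> OY" "q \<in> OY"
  shows "min 1 (cone_dist Y p q) \<le> wd p q"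
proof -
  let ?u = "\<lambda>x. min 1 (cone_dist Y p x)"
  have "cone_action \<phi> s x \<in> OY" if "x \<in> OY" "s \<in> S" for x s
    using that act_closed S_subset by (auto simp: cone_action_def inf_cone_def)
  then have "\<bar>?u p - ?u q\<bar> \<le> wd p q"
  proof (intro wd_ge_test_function assms)
    fix x y assume xy: "x \<in> OY" "y \<in> OY"
    show "\<bar>?u x - ?u y\<bar> \<le> cone_dist Y x y"
      using cone_dist_triangle[OF bounded_Y assms(1) xy] cone_dist_nonneg[OF xy]
        cone_dist_triangle[OF bounded_Y assms(1) xy(2,1)] cone_dist_commute[of x y] by linarith
  next
    fix x s assume "x \<in> OY" "s \<in> S"
      "\<And>x s. x \<in> OY \<Longrightarrow> s \<in> S \<Longrightarrow> cone_action \<phi> s x \<in> OY"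
    then show "\<bar>?u x - ?u (cone_action \<phi> s x)\<bar> \<le> 1"
      using cone_dist_nonneg[OF assms(1), of x]
        cone_dist_nonneg[OF assms(1), of "cone_action \<phi> s x"] by auto
  qed
  then show ?thesis
    using cone_dist_nonneg[OF assms] by (simp add: cone_dist_def)
qed

lemma wd_word:
  assumes "0 < r" "y \<in> Y" "g \<in> word_ball G S k"
  shows "wd (r, y) (r, \<phi> g y) \<le> real k"
  using assms(2,3)
proof (induction k arbitrary: g y)
  case 0
  then show ?case
    using \<open>0 < r\<close> by (simp add: act_one in_cone)
next
  case (Suc k)
  have step: "wd (r, z) (r, \<phi> s z) \<le> 1 \<and> wd (r, z) (r, \<phi> (inv s) z) \<le> 1"
    if "s \<in> S" "z \<in> Y" for s z
  proof -
    have s: "s \<in> carrier G" "\<phi> (inv s) z \<in> Y"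
      using that S_subset act_closed by auto
    show ?thesis
      using wd_generator[of "(r, z)" s] wd_generator[of "(r, \<phi> (inv s) z)" s] that s \<open>0 < r\<close>
      by (simp add: in_cone cone_action_def act_inv' warped.commute)
  qed
  from Suc.prems consider "g \<in> word_ball G S k"
    | u s where "u \<in> word_ball G S k" "s \<in> S" "g = u \<otimes> s \<or> g = u \<otimes> inv s"
    by auto
  then show ?case
  proof cases
    case 1
    then show ?thesis
      using Suc by force
  next
    case 2
    then have c: "u \<in> carrier G" "s \<in> carrier G"
      using S_subset word_ball_subset_carrier[OF S_subset] by auto
    then obtain t where t: "t = s \<or> t = inv s" "g = u \<otimes> t" "t \<in> carrier G"
      using 2 by auto
    define z where "z = \<phi> t y"
    have z: "z \<in> Y" "\<phi> g y = \<phi> u z"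
      using t c Suc.prems(1) by (auto simp: z_def act_closed act_mult)
    have "wd (r, y) (r, \<phi> u z) \<le> wd (r, y) (r, z) + wd (r, z) (r, \<phi> u z)"
      using z Suc.prems(1) c act_closed \<open>0 < r\<close> by (intro warped.triangle) (auto simp: in_cone)
    also have "wd (r, y) (r, z) \<le> 1"
      using step[OF \<open>s \<in> S\<close> Suc.prems(1)] t by (auto simp: z_def)
    also have "wd (r, z) (r, \<phi> u z) \<le> real k"
      using Suc.IH[OF z(1)] 2 by blast
    finally show ?thesis
      by (simp add: z)
  qed
qed

section \<open>Coarse geometry of large levels\<close>

text \<open>
  On levels above the Lipschitz constant \<open>K\<close> the cone metric is expanded enough to make \<open>v\<close>
  \<open>1\<close>-Lipschitz. Lower levels are a radial distance at least \<open>L\<close> away, so there the radial term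
  takes over from \<open>v\<close>.
\<close>

lemma wd_ge_Lipschitz:
  assumes v: "\<And>z. z \<in> Y \<Longrightarrow> 0 \<le> v z" "\<And>z. z \<in> Y \<Longrightarrow> v z \<le> L"
    and lip: "\<And>z z'. z \<in> Y \<Longrightarrow> z' \<in> Y \<Longrightarrow> v z \<le> v z' + K * dist z z'"
    and gen: "\<And>z s. z \<in> Y \<Longrightarrow> s \<in> S \<Longrightarrow> \<bar>v z - v (\<phi> s z)\<bar> \<le> 1"
    and r: "0 < r" "K + L / diameter Y \<le> r"
    and y: "y \<in> Y" "v y = 0" and q: "q \<in> OY"
  shows "v (snd q) \<le> wd (r, y) q"
proof -
  define D where "D = diameter Y"
  have D: "0 < D"
    using diameter_pos by (simp add: D_def)
  define h where "h a = D * \<bar>r - a\<bar>" for a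
  define u where "u p = max (v (snd p)) (h (fst p))" for p
  have rad: "h a \<le> h b + \<bar>a - b\<bar> * D" for a b
  proof -
    have "D * \<bar>r - a\<bar> \<le> D * (\<bar>r - b\<bar> + \<bar>a - b\<bar>)"
      using D by (intro mult_left_mono) auto
    then show ?thesis
      by (simp add: h_def distrib_left mult.commute)
  qed
  have one_sided: "u p \<le> u q + cone_dist Y p q" if "p \<in> OY" "q \<in> OY" for p q
  proof -
    obtain a x b z where pq: "p = (a, x)" "q = (b, z)"
      by (metis surj_pair)
    then have pos: "0 < a" "0 < b" "x \<in> Y" "z \<in> Y"
      using that by (auto simp: in_cone)
    define A where "A = \<bar>a - b\<bar> * D"
    define m where "m = min a b * dist x z"
    have cd: "cone_dist Y p q = A + m"
      by (simp add: cone_dist_def D_def pq A_def m_def)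
    have nn: "0 \<le> m" "0 \<le> A"
      using pos D by (auto simp: A_def m_def)
    have u: "v z \<le> u q" "h b \<le> u q"
      by (simp_all add: u_def pq)
    have hab: "h a \<le> h b + A"
      using rad[of a b] by (simp add: A_def)
    have "v x \<le> u q + (A + m)"
    proof (cases "K \<le> min a b")
      case True
      then have "K * dist x z \<le> m"
        unfolding m_def by (intro mult_right_mono) auto
      then show ?thesis
        using lip[OF pos(3,4)] nn u by linarith
    next
      case False
      then have "L / D \<le> r - a \<or> L / D \<le> r - b"
        using r(2) by (auto simp: D_def)
      then have "L / D \<le> \<bar>r - a\<bar> \<or> L / D \<le> \<bar>r - b\<bar>"
        by linarith
      then have "L \<le> h a \<or> L \<le> h b"
        using D by (simp add: h_def pos_divide_le_eq mult.commute)
      then show ?thesis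
        using hab nn u v(2)[OF pos(3)] by linarith
    qed
    moreover have "h a \<le> u q + (A + m)"
      using hab nn u by linarith
    moreover have "u p = max (v x) (h a)"
      by (simp add: u_def pq)
    ultimately show ?thesis
      by (simp add: cd)
  qed
  have "\<bar>u (r, y) - u q\<bar> \<le> wd (r, y) q"
  proof (rule wd_ge_test_function)
    fix p p' assume pp: "p \<in> OY" "p' \<in> OY"
    show "\<bar>u p - u p'\<bar> \<le> cone_dist Y p p'"
      using one_sided[OF pp] one_sided[OF pp(2,1)] cone_dist_commute[of p p'] by linarith
  next
    fix p s assume "p \<in> OY" "s \<in> S"
    then have "\<bar>v (snd p) - v (\<phi> s (snd p))\<bar> \<le> 1"
      by (intro gen) (auto simp: inf_cone_def)
    then show "\<bar>u p - u (cone_action \<phi> s p)\<bar> \<le> 1"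
      unfolding u_def cone_action_def fst_conv snd_conv by linarith
  qed (use q r y in \<open>auto simp: in_cone\<close>)
  moreover have "u (r, y) = 0"
    by (simp add: u_def h_def y)
  moreover have "v (snd q) \<le> u q"
    by (simp add: u_def)
  ultimately show ?thesis
    by linarith
qed

end

text \<open>
  Infimal convolution with a steep cone: a function that varies by at most \<open>1\<close> at scale \<open>\<eta>\<close> is
  Lipschitz up to an error \<open>1\<close>, with a constant depending only on \<open>\<eta>\<close> and its upper bound.
\<close>

lemma Lipschitz_regularization:
  fixes v :: "'y::metric_space \<Rightarrow> real"
  assumes v: "\<And>z. z \<in> Y \<Longrightarrow> 0 \<le> v z" "\<And>z. z \<in> Y \<Longrightarrow> v z \<le> L"
    and \<eta>: "0 < \<eta>" "\<And>z z'. z \<in> Y \<Longrightarrow> z' \<in> Y \<Longrightarrow> dist z z' < \<eta> \<Longrightarrow> v z \<le> v z' + 1"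
    and L: "0 \<le> L"
  shows "\<exists>w. (\<forall>z\<in>Y. 0 \<le> w z \<and> w z \<le> v z \<and> v z \<le> w z + 1) \<and>
    (\<forall>z\<in>Y. \<forall>z'\<in>Y. w z \<le> w z' + L / \<eta> * dist z z')"
proof -
  define K where "K = L / \<eta>"
  have K: "0 \<le> K"
    using L \<eta> by (simp add: K_def)
  define w where "w z = (INF x\<in>Y. v x + K * dist x z)" for z
  have low: "0 \<le> v x + K * dist x z" if "x \<in> Y" for x z
    using v(1)[OF that] K by simp
  have w_le: "w z \<le> v x + K * dist x z" if "x \<in> Y" for x z
    unfolding w_def using low that by (intro cINF_lower bdd_belowI2[of _ 0]) auto
  have w_ge: "c \<le> w z" if "z \<in> Y" "\<And>x. x \<in> Y \<Longrightarrow> c \<le> v x + K * dist x z" for c z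
    unfolding w_def using that by (intro cINF_greatest) auto
  have w1: "0 \<le> w z" if "z \<in> Y" for z
    using that low by (intro w_ge) auto
  have w2: "w z \<le> v z" if "z \<in> Y" for z
    using w_le[OF that, of z] by simp
  have w3: "v z \<le> w z + 1" if z: "z \<in> Y" for z
  proof -
    have "v z - 1 \<le> v x + K * dist x z" if x: "x \<in> Y" for x
    proof (cases "dist z x < \<eta>")
      case True
      have "0 \<le> K * dist x z"
        using K by simp
      then show ?thesis
        using \<eta>(2)[OF z x True] by linarith
    next
      case False
      then have "K * \<eta> \<le> K * dist x z"
        using K by (intro mult_left_mono) (auto simp: dist_commute)
      then show ?thesis
        using v(2)[OF z] v(1)[OF x] \<eta>(1) by (simp add: K_def)
    qed
    then show ?thesis
      using w_ge[OF z, of "v z - 1"] by simp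
  qed
  have w4: "w z \<le> w z' + L / \<eta> * dist z z'" if z: "z \<in> Y" "z' \<in> Y" for z z'
  proof -
    have "w z - K * dist z z' \<le> v x + K * dist x z'" if x: "x \<in> Y" for x
    proof -
      have "K * dist x z \<le> K * (dist x z' + dist z z')"
        using K dist_triangle[of x z z'] by (intro mult_left_mono) (auto simp: dist_commute)
      then show ?thesis
        using w_le[OF x, of z] by (simp add: algebra_simps)
    qed
    then show ?thesis
      using w_ge[OF z(2), of "w z - K * dist z z'"] by (simp add: K_def)
  qed
  show ?thesis
    using w1 w2 w3 w4 by (intro exI[of _ w]) auto
qed

context compact_action
begin

text \<open>
  A coarse distance from \<open>z\<close> to \<open>y\<close> along orbits: move \<open>z\<close> by a group element of word length
  \<open>k\<close>, at price \<open>k\<close>, then pay \<open>\<kappa>\<close> times the remaining distance to \<open>y\<close>; the total is capped at \<open>L\<close>.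
\<close>

definition orbit_cost :: "real \<Rightarrow> real \<Rightarrow> 'y \<Rightarrow> 'y \<Rightarrow> real" where
  "orbit_cost L \<kappa> y z =
     min L (Inf {real k + \<kappa> * dist (\<phi> h z) y | k h. h \<in> word_ball G S k})"

lemma orbit_cost_le_cap: "orbit_cost L \<kappa> y z \<le> L"
  by (simp add: orbit_cost_def)

lemma orbit_cost_nonneg:
  assumes "0 \<le> L" "0 \<le> \<kappa>"
  shows "0 \<le> orbit_cost L \<kappa> y z"
proof -
  let ?T = "{real k + \<kappa> * dist (\<phi> h z) y | k h. h \<in> word_ball G S k}"
  have "?T \<noteq> {}"
    using one_in_word_ball by blast
  then have "0 \<le> Inf ?T"
    using assms(2) by (intro cInf_greatest) auto
  then show ?thesis
    using assms(1) by (simp add: orbit_cost_def)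
qed

lemma orbit_cost_le:
  assumes "0 \<le> \<kappa>" "h \<in> word_ball G S k"
  shows "orbit_cost L \<kappa> y z \<le> real k + \<kappa> * dist (\<phi> h z) y"
proof -
  have "Inf {real k + \<kappa> * dist (\<phi> h z) y | k h. h \<in> word_ball G S k} \<le> real k + \<kappa> * dist (\<phi> h z) y"
    using assms by (intro cInf_lower bdd_belowI[of _ 0]) auto
  then show ?thesis
    by (simp add: orbit_cost_def)
qed

lemma orbit_cost_lessE:
  assumes "orbit_cost L \<kappa> y z < c" "c \<le> L"
  obtains k h where "h \<in> word_ball G S k" "real k + \<kappa> * dist (\<phi> h z) y < c"
proof -
  let ?T = "{real k + \<kappa> * dist (\<phi> h z) y | k h. h \<in> word_ball G S k}"
  have "Inf ?T < c"
    using assms by (auto simp: orbit_cost_def)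
  moreover have "?T \<noteq> {}"
    using one_in_word_ball by blast
  ultimately obtain t where "t \<in> ?T" "t < c"
    using cInf_lessD[of ?T c] by auto
  then show thesis
    using that by blast
qed

lemma orbit_cost_generator:
  assumes "0 \<le> \<kappa>" "z \<in> Y" "s \<in> S" "t = s \<or> t = inv s"
  shows "orbit_cost L \<kappa> y z \<le> orbit_cost L \<kappa> y (\<phi> t z) + 1"
proof (rule ccontr)
  assume "\<not> ?thesis"
  then have "orbit_cost L \<kappa> y (\<phi> t z) < orbit_cost L \<kappa> y z - 1" "orbit_cost L \<kappa> y z - 1 \<le> L"
    using orbit_cost_le_cap[of L \<kappa> y z] by auto
  then obtain k h where h: "h \<in> word_ball G S k"
    "real k + \<kappa> * dist (\<phi> h (\<phi> t z)) y < orbit_cost L \<kappa> y z - 1"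
    by (rule orbit_cost_lessE)
  have c: "h \<in> carrier G" "t \<in> carrier G"
    using h(1) word_ball_subset_carrier[OF S_subset] assms S_subset by auto
  have "h \<otimes> t \<in> word_ball G S (Suc k)"
    using h(1) assms by auto
  then have "orbit_cost L \<kappa> y z \<le> real (Suc k) + \<kappa> * dist (\<phi> (h \<otimes> t) z) y"
    by (rule orbit_cost_le[OF \<open>0 \<le> \<kappa>\<close>])
  then show False
    using h(2) c \<open>z \<in> Y\<close> by (simp add: act_mult)
qed

lemma orbit_cost_equicontinuous:
  assumes "0 \<le> \<kappa>" and z: "z \<in> Y" "z' \<in> Y"
    and close: "\<And>h. h \<in> word_ball G S l \<Longrightarrow> \<kappa> * dist (\<phi> h z) (\<phi> h z') \<le> 1"
  shows "orbit_cost (real l) \<kappa> y z \<le> orbit_cost (real l) \<kappa> y z' + 1"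
proof (rule ccontr)
  let ?v = "orbit_cost (real l) \<kappa> y"
  assume "\<not> ?thesis"
  then have "?v z' < ?v z - 1" "?v z - 1 \<le> real l"
    using orbit_cost_le_cap[of "real l" \<kappa> y z] by auto
  then obtain k h where h: "h \<in> word_ball G S k" "real k + \<kappa> * dist (\<phi> h z') y < ?v z - 1"
    by (rule orbit_cost_lessE)
  have "0 \<le> \<kappa> * dist (\<phi> h z') y"
    using \<open>0 \<le> \<kappa>\<close> by simp
  then have "k \<le> l"
    using h(2) orbit_cost_le_cap[of "real l" \<kappa> y z] by linarith
  then have "\<kappa> * dist (\<phi> h z) (\<phi> h z') \<le> 1"
    using close h(1) word_ball_mono[of k l G S] by blast
  moreover have "\<kappa> * dist (\<phi> h z) y \<le> \<kappa> * (dist (\<phi> h z) (\<phi> h z') + dist (\<phi> h z') y)"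
    using \<open>0 \<le> \<kappa>\<close> by (intro mult_left_mono dist_triangle) auto
  ultimately have "real k + \<kappa> * dist (\<phi> h z) y < ?v z"
    using h(2) by (simp add: distrib_left)
  then show False
    using orbit_cost_le[OF \<open>0 \<le> \<kappa>\<close> h(1), of "real l" y z] by linarith
qed

text \<open>
  The geometric core: as the level grows, warped balls of fixed radius shrink onto orbit segments
  \<open>F y\<close> with \<open>F\<close> independent of the level. The test function is a regularized orbit cost; halving
  it absorbs the errors of the regularization.
\<close>

lemma warped_ball_near_orbit:
  fixes N :: nat
  shows "\<exists>F. finite F \<and> F \<subseteq> carrier G \<and>
    (\<forall>e>0. \<exists>R>0. \<forall>r\<ge>R. \<forall>y\<in>Y. \<forall>q\<in>OY. wd (r, y) q < real N \<longrightarrow> (\<exists>g\<in>F. dist (snd q) (\<phi> g y) < e))"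
proof -
  \<comment> \<open>where the cost reaches the cap \<open>l\<close>, regularizing and halving it leaves at least \<open>(l - 1) / 2 = N\<close>\<close>
  define l where "l = 2 * N + 1"
  define B where "B = word_ball G S l"
  have B: "finite B" "B \<subseteq> carrier G"
    using finite_word_ball[OF finite_S] word_ball_subset_carrier[OF S_subset] by (auto simp: B_def)
  define F where "F = (\<lambda>h. inv h) ` B"
  have F: "finite F" "F \<subseteq> carrier G"
    using B by (auto simp: F_def)
  have "\<exists>R>0. \<forall>r\<ge>R. \<forall>y\<in>Y. \<forall>q\<in>OY. wd (r, y) q < real N \<longrightarrow> (\<exists>g\<in>F. dist (snd q) (\<phi> g y) < e)"
    if "0 < e" for e
  proof -
    from uniform_modulus[OF F \<open>0 < e\<close>] obtain d where d: "0 < d"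
      "\<And>g x y. g \<in> F \<Longrightarrow> x \<in> Y \<Longrightarrow> y \<in> Y \<Longrightarrow> dist x y < d \<Longrightarrow> dist (\<phi> g x) (\<phi> g y) < e"
      by blast
    \<comment> \<open>the price that makes a point of cost below the cap \<open>l\<close> come \<open>d\<close>-close to the target\<close>
    define \<kappa> where "\<kappa> = real l / d"
    have \<kappa>: "0 < \<kappa>"
      using d by (simp add: \<kappa>_def l_def)
    from uniform_modulus[OF B, of "1 / \<kappa>"] \<kappa> obtain \<eta> where \<eta>: "0 < \<eta>"
      "\<And>h x y. h \<in> B \<Longrightarrow> x \<in> Y \<Longrightarrow> y \<in> Y \<Longrightarrow> dist x y < \<eta> \<Longrightarrow> dist (\<phi> h x) (\<phi> h y) < 1 / \<kappa>"
      by auto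
    define K where "K = real l / \<eta>"
    have K: "0 < K"
      using \<eta>(1) by (simp add: K_def l_def)
    define R where "R = K + real l / diameter Y"
    have "0 < R"
      unfolding R_def using K diameter_pos by (intro add_pos_nonneg) auto
    moreover have "\<exists>g\<in>F. dist (snd q) (\<phi> g y) < e"
      if r: "R \<le> r" and y: "y \<in> Y" and q: "q \<in> OY" and near: "wd (r, y) q < real N" for r y q
    proof -
      define v where "v = orbit_cost (real l) \<kappa> y"
      have v: "0 \<le> v z" "v z \<le> real l" for z
        using orbit_cost_nonneg[of "real l" \<kappa> y z] orbit_cost_le_cap \<kappa> by (auto simp: v_def)
      have small_variation: "v z \<le> v z' + 1" if "z \<in> Y" "z' \<in> Y" "dist z z' < \<eta>" for z z'
        unfolding v_def
      proof (rule orbit_cost_equicontinuous)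
        fix h assume "h \<in> word_ball G S l"
        then have "dist (\<phi> h z) (\<phi> h z') < 1 / \<kappa>"
          using \<eta>(2) that by (auto simp: B_def)
        then show "\<kappa> * dist (\<phi> h z) (\<phi> h z') \<le> 1"
          using \<kappa> by (simp add: field_simps)
      qed (use that \<kappa> in auto)
      have "\<exists>w. (\<forall>z\<in>Y. 0 \<le> w z \<and> w z \<le> v z \<and> v z \<le> w z + 1) \<and>
          (\<forall>z\<in>Y. \<forall>z'\<in>Y. w z \<le> w z' + K * dist z z')"
        unfolding K_def
        by (rule Lipschitz_regularization[of Y v]) (use v \<eta>(1) small_variation in simp_all)
      then obtain w where w': "\<forall>z\<in>Y. 0 \<le> w z \<and> w z \<le> v z \<and> v z \<le> w z + 1"
        and w_lip: "\<forall>z\<in>Y. \<forall>z'\<in>Y. w z \<le> w z' + K * dist z z'"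
        by (elim exE conjE)
      have w: "0 \<le> w z" "w z \<le> v z" "v z \<le> w z + 1" if "z \<in> Y" for z
        using w' that by auto
      have "v y \<le> 0"
        using orbit_cost_le[of \<kappa> \<one> 0 "real l" y y] y \<kappa> by (simp add: v_def act_one)
      then have "w y = 0"
        using w(1,2)[OF y] by linarith
      have "w (snd q) / 2 \<le> wd (r, y) q"
      proof (rule wd_ge_Lipschitz[where v = "\<lambda>z. w z / 2" and L = "real l" and K = K])
        fix z assume z: "z \<in> Y"
        show "0 \<le> w z / 2" "w z / 2 \<le> real l"
          using w(1,2)[OF z] v[of z] by linarith+
        show "w z / 2 \<le> w z' / 2 + K * dist z z'" if z': "z' \<in> Y" for z'
        proof -
          have "0 \<le> K * dist z z'"
            using K by simp
          then show ?thesis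
            using bspec[OF bspec[OF w_lip z] z'] by linarith
        qed
        show "\<bar>w z / 2 - w (\<phi> s z) / 2\<bar> \<le> 1" if s: "s \<in> S" for s
        proof -
          have sz: "\<phi> s z \<in> Y" "\<phi> (inv s) (\<phi> s z) = z"
            using s S_subset z by (auto simp: act_closed act_inv)
          have "v z \<le> v (\<phi> s z) + 1" "v (\<phi> s z) \<le> v z + 1"
            using orbit_cost_generator[of \<kappa> z s s] orbit_cost_generator[of \<kappa> "\<phi> s z" s "inv s"]
              s z sz \<kappa> by (auto simp: v_def)
          then show ?thesis
            using w(2,3)[OF z] w(2,3)[OF sz(1)] unfolding abs_le_iff by linarith
        qed
      next
        show "w y / 2 = 0"
          using \<open>w y = 0\<close> by simp
      qed (use r y q \<open>0 < R\<close> in \<open>auto simp: R_def\<close>)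
      moreover have z: "snd q \<in> Y"
        using q by (auto simp: inf_cone_def)
      ultimately have "v (snd q) < real l"
        using near w(3)[OF z] by (simp add: l_def)
      then obtain k h where h: "h \<in> word_ball G S k" "real k + \<kappa> * dist (\<phi> h (snd q)) y < real l"
        unfolding v_def using orbit_cost_lessE by (metis order_refl)
      have "0 \<le> \<kappa> * dist (\<phi> h (snd q)) y"
        using \<kappa> by simp
      moreover have "\<kappa> * d = real l"
        using d(1) by (simp add: \<kappa>_def)
      ultimately have "real k \<le> real l" "\<kappa> * dist (\<phi> h (snd q)) y < \<kappa> * d"
        using h(2) by linarith+
      then have hB: "h \<in> B" "dist (\<phi> h (snd q)) y < d"
        using h(1) word_ball_mono[of k l G S] \<kappa> by (auto simp: B_def)
      then have hG: "h \<in> carrier G"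
        using B by blast
      have "dist (\<phi> (inv h) (\<phi> h (snd q))) (\<phi> (inv h) y) < e"
        using hB y hG z by (intro d(2)) (auto simp: F_def act_closed)
      then have "dist (snd q) (\<phi> (inv h) y) < e"
        using hG z by (simp add: act_inv)
      then show ?thesis
        using hB(1) by (auto simp: F_def)
    qed
    ultimately show ?thesis
      by blast
  qed
  then show ?thesis
    using F by blast
qed

section \<open>Measures on the warped cone\<close>

lemma openin_warped_imp_openin_euclidean:
  assumes "openin warped.mtopology U"
  shows "openin (top_of_set OY) U"
  unfolding openin_euclidean_subtopology_iff
proof (intro conjI ballI)
  show "U \<subseteq> OY"
    using assms by (simp add: warped.openin_mtopology)
  fix p assume "p \<in> U"
  then obtain e where e: "0 < e" "warped.mball p e \<subseteq> U"
    using assms unfolding warped.openin_mtopology by blast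
  have p: "p \<in> OY"
    using \<open>p \<in> U\<close> \<open>U \<subseteq> OY\<close> by blast
  define c where "c = diameter Y + fst p"
  have c: "0 < c"
    using p diameter_pos by (auto simp: c_def inf_cone_def)
  have "q \<in> U" if q: "q \<in> OY" "dist q p < e / c" for q
  proof -
    have "\<bar>fst p - fst q\<bar> \<le> dist q p" "dist (snd p) (snd q) \<le> dist q p"
      using dist_fst_le[of q p] dist_snd_le[of q p] by (auto simp: dist_real_def dist_commute)
    moreover have "min (fst p) (fst q) * dist (snd p) (snd q) \<le> fst p * dist (snd p) (snd q)"
      by (intro mult_right_mono) auto
    moreover have "fst p * dist (snd p) (snd q) \<le> fst p * dist q p"
      using calculation(2) p by (intro mult_left_mono) (auto simp: inf_cone_def)
    moreover have "\<bar>fst p - fst q\<bar> * diameter Y \<le> dist q p * diameter Y"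
      using calculation(1) diameter_pos by (intro mult_right_mono) auto
    ultimately have "cone_dist Y p q \<le> c * dist q p"
      unfolding cone_dist_def c_def distrib_right by (simp add: mult.commute)
    also have "\<dots> < e"
      using q(2) c by (simp add: field_simps)
    finally have "wd p q < e"
      using wd_le_cone_dist[OF p q(1)] by simp
    then show ?thesis
      using e(2) p q(1) by (auto simp: warped.in_mball)
  qed
  then show "\<exists>d>0. \<forall>q\<in>OY. dist q p < d \<longrightarrow> q \<in> U"
    using e(1) c by (intro exI[of _ "e / c"]) auto
qed

lemma openin_warped_snd:
  assumes "open V"
  shows "openin warped.mtopology {q \<in> OY. snd q \<in> V}"
  unfolding warped.openin_mtopology
proof (intro conjI allI impI)
  fix p assume "p \<in> {q \<in> OY. snd q \<in> V}"
  then have p: "p \<in> OY" "snd p \<in> V" "0 < fst p"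
    by (auto simp: inf_cone_def)
  then obtain e where e: "0 < e" "ball (snd p) e \<subseteq> V"
    using assms by (meson openE)
  let ?r = "fst p" and ?D = "diameter Y"
  define \<rho> where "\<rho> = min 1 (min (?r * ?D / 2) (?r * e / 2))"
  have "0 < \<rho>"
    using p(3) diameter_pos e(1) by (simp add: \<rho>_def)
  moreover have "snd q \<in> V" if q: "q \<in> OY" "wd p q < \<rho>" for q
  proof -
    have "cone_dist Y p q < \<rho>"
      using min_cone_dist_le_wd[OF p(1) q(1)] q(2) by (auto simp: \<rho>_def)
    moreover have nn: "0 \<le> \<bar>?r - fst q\<bar> * ?D" "0 \<le> min ?r (fst q) * dist (snd p) (snd q)"
      using p q diameter_pos by (auto simp: inf_cone_def)
    ultimately have "\<bar>?r - fst q\<bar> * ?D < ?r / 2 * ?D" and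
      d: "min ?r (fst q) * dist (snd p) (snd q) < ?r * e / 2"
      by (auto simp: cone_dist_def \<rho>_def)
    then have "\<bar>?r - fst q\<bar> < ?r / 2"
      using diameter_pos by (simp only: mult_less_cancel_right_pos)
    then have "?r / 2 \<le> min ?r (fst q)"
      using p(3) by linarith
    then have "?r / 2 * dist (snd p) (snd q) \<le> min ?r (fst q) * dist (snd p) (snd q)"
      by (intro mult_right_mono) auto
    then have "?r * dist (snd p) (snd q) < ?r * e"
      using d by simp
    then have "dist (snd p) (snd q) < e"
      using p(3) by simp
    then show ?thesis
      using e(2) by auto
  qed
  ultimately show "\<exists>r>0. warped.mball p r \<subseteq> {q \<in> OY. snd q \<in> V}"
    by (intro exI[of _ \<rho>]) (auto simp: warped.in_mball)
qed auto

lemma space_warped_borel: "space warped.borel_sigma = OY"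
  unfolding warped.borel_sigma_def by (rule space_measure_of_conv)

lemma openin_warped_borel: "openin warped.mtopology U \<Longrightarrow> U \<in> sets warped.borel_sigma"
  unfolding warped.borel_sigma_def
  by (subst sets_measure_of) (use warped.openin_mtopology in blast)+

text \<open>
  By \<open>\<sigma>\<close>-compactness of the cone, countably many null open sets cover everything outside a ball that
  contains the support.
\<close>

lemma AE_mball_of_msupport:
  assumes \<mu>: "\<mu> \<in> space (prob_algebra warped.borel_sigma)"
    and supp: "warped.msupport \<mu> \<subseteq> warped.mball p \<rho>"
  shows "AE q in \<mu>. wd p q < \<rho>"
proof -
  have sets: "sets \<mu> = sets warped.borel_sigma" and space: "space \<mu> = OY"
    using \<mu> sets_eq_imp_space_eq space_warped_borel by (auto simp: space_prob_algebra)
  define K where "K n = {1 / real (Suc n)..real (Suc n)} \<times> Y" for n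
  have "\<exists>Z\<in>null_sets \<mu>. K n \<subseteq> warped.mball p \<rho> \<union> Z" for n
  proof -
    let ?N = "{U. openin warped.mtopology U \<and> emeasure \<mu> U = 0}"
    have sub: "K n \<subseteq> OY"
      by (auto simp: K_def inf_cone_def intro: less_le_trans[of 0 "1 / real (Suc n)"])
    have "compactin (top_of_set OY) (K n)"
      using sub compact_Y
      by (simp add: compactin_subtopology K_def compact_Times)
    then have "\<forall>\<U>. (\<forall>U\<in>\<U>. openin (top_of_set OY) U) \<and> K n \<subseteq> \<Union>\<U> \<longrightarrow>
        (\<exists>\<F>. finite \<F> \<and> \<F> \<subseteq> \<U> \<and> K n \<subseteq> \<Union>\<F>)"
      by (simp add: compactin_def)
    moreover have "\<forall>U\<in>insert (warped.mball p \<rho>) ?N. openin (top_of_set OY) U"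
      using openin_warped_imp_openin_euclidean by auto
    moreover have "K n \<subseteq> \<Union>(insert (warped.mball p \<rho>) ?N)"
    proof
      fix q assume "q \<in> K n"
      then have "q \<in> OY"
        using sub by blast
      show "q \<in> \<Union>(insert (warped.mball p \<rho>) ?N)"
      proof (cases "q \<in> warped.msupport \<mu>")
        case True
        then show ?thesis
          using supp by auto
      next
        case False
        then show ?thesis
          using \<open>q \<in> OY\<close> by (auto simp: warped.msupport_def)
      qed
    qed
    ultimately obtain \<F> where \<F>: "finite \<F>" "\<F> \<subseteq> insert (warped.mball p \<rho>) ?N" "K n \<subseteq> \<Union>\<F>"
      by meson
    have "\<Union>(\<F> - {warped.mball p \<rho>}) \<in> null_sets \<mu>"
      using \<F> openin_warped_borel sets by (intro null_sets.finite_Union) (auto simp: null_sets_def)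
    moreover have "K n \<subseteq> warped.mball p \<rho> \<union> \<Union>(\<F> - {warped.mball p \<rho>})"
      using \<F>(3) by blast
    ultimately show ?thesis
      by blast
  qed
  then obtain Z where Z: "\<And>n. Z n \<in> null_sets \<mu>" "\<And>n. K n \<subseteq> warped.mball p \<rho> \<union> Z n"
    by metis
  have null: "AE q in \<mu>. \<forall>n. q \<notin> Z n"
    using Z(1) by (simp add: AE_all_countable AE_not_in)
  have "wd p q < \<rho>" if q: "q \<in> space \<mu>" "\<forall>n. q \<notin> Z n" for q
  proof -
    have pos: "0 < fst q" "snd q \<in> Y"
      using q(1) unfolding space inf_cone_def by auto
    obtain n where n: "max (fst q) (1 / fst q) \<le> real n"
      using real_arch_simple[of "max (fst q) (1 / fst q)"] ..
    then have "fst q \<le> real (Suc n)" "1 / fst q \<le> real (Suc n)"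
      by auto
    then have "fst q \<le> real (Suc n)" "1 / real (Suc n) \<le> fst q"
      using pos by (auto simp: pos_divide_le_eq mult.commute)
    then have "q \<in> K n"
      using pos by (cases q) (simp add: K_def)
    then show ?thesis
      using Z(2)[of n] q(2) by (auto simp: warped.in_mball)
  qed
  then show ?thesis
    by (intro AE_mp[OF null AE_I2]) blast
qed

section \<open>Coding points of the cone by group elements\<close>

text \<open>
  If the translates \<open>F z\<close> are \<open>2e\<close>-separated, a point of the cone whose base coordinate is
  \<open>e\<close>-close to \<open>g z\<close> determines \<open>g\<close>. Points away from \<open>F z\<close> get the junk code \<open>\<one>\<close>.
\<close>

definition orbit_code :: "'g set \<Rightarrow> real \<Rightarrow> 'y \<Rightarrow> real \<times> 'y \<Rightarrow> 'g" where
  "orbit_code F e z q =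
     (if \<exists>g\<in>F. dist (snd q) (\<phi> g z) < e then SOME g. g \<in> F \<and> dist (snd q) (\<phi> g z) < e else \<one>)"

lemma orbit_code_eq:
  assumes sep: "\<And>g h y. g \<in> F \<Longrightarrow> h \<in> F \<Longrightarrow> g \<noteq> h \<Longrightarrow> y \<in> Y \<Longrightarrow> 2 * e \<le> dist (\<phi> g y) (\<phi> h y)"
    and z: "z \<in> Y" and g: "g \<in> F" "dist (snd q) (\<phi> g z) < e"
  shows "orbit_code F e z q = g"
proof -
  have unique: "h = g" if h: "h \<in> F" "dist (snd q) (\<phi> h z) < e" for h
  proof (rule ccontr)
    assume "h \<noteq> g"
    then have "2 * e \<le> dist (\<phi> h z) (\<phi> g z)"
      using sep h g z by blast
    moreover have "dist (\<phi> h z) (\<phi> g z) \<le> dist (snd q) (\<phi> h z) + dist (snd q) (\<phi> g z)"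
      by (rule dist_triangle3)
    ultimately show False
      using h g by linarith
  qed
  have "(SOME h. h \<in> F \<and> dist (snd q) (\<phi> h z) < e) = g"
    by (rule some_equality) (simp add: g, elim conjE, rule unique)
  moreover have "\<exists>h\<in>F. dist (snd q) (\<phi> h z) < e"
    using g by (rule bexI[rotated])
  ultimately show ?thesis
    by (simp add: orbit_code_def)
qed

lemma measurable_orbit_code:
  assumes F: "finite F" "F \<subseteq> carrier G"
    and sep: "\<And>g h y. g \<in> F \<Longrightarrow> h \<in> F \<Longrightarrow> g \<noteq> h \<Longrightarrow> y \<in> Y \<Longrightarrow> 2 * e \<le> dist (\<phi> g y) (\<phi> h y)"
    and z: "z \<in> Y"
  shows "orbit_code F e z \<in> measurable warped.borel_sigma (count_space (carrier G))"
proof (rule measurableI)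
  define U where "U g = {q \<in> OY. snd q \<in> ball (\<phi> g z) e}" for g
  have U: "U g \<in> sets warped.borel_sigma" for g
    unfolding U_def by (intro openin_warped_borel openin_warped_snd) simp
  have code: "orbit_code F e z q = g" if "q \<in> U g" "g \<in> F" for q g
    using that by (intro orbit_code_eq[OF sep z]) (auto simp: U_def dist_commute)
  have junk: "orbit_code F e z q = \<one>" if "q \<in> OY" "\<And>g. g \<in> F \<Longrightarrow> q \<notin> U g" for q
    using that by (auto simp: U_def orbit_code_def dist_commute)
  show "orbit_code F e z q \<in> space (count_space (carrier G))" if "q \<in> space warped.borel_sigma" for q
  proof (cases "\<exists>g\<in>F. q \<in> U g")
    case True
    then obtain g where "g \<in> F" "q \<in> U g"
      by blast
    then show ?thesis
      using code[of q g] F(2) by auto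
  next
    case False
    then show ?thesis
      using junk[of q] that by (simp add: space_warped_borel)
  qed
  fix Z assume "Z \<in> sets (count_space (carrier G))"
  have "orbit_code F e z -` Z \<inter> space warped.borel_sigma =
      (\<Union>g\<in>F \<inter> Z. U g) \<union> (if \<one> \<in> Z then space warped.borel_sigma - (\<Union>g\<in>F. U g) else {})"
  proof (intro Set.set_eqI)
    fix q
    show "q \<in> orbit_code F e z -` Z \<inter> space warped.borel_sigma \<longleftrightarrow>
      q \<in> (\<Union>g\<in>F \<inter> Z. U g) \<union> (if \<one> \<in> Z then space warped.borel_sigma - (\<Union>g\<in>F. U g) else {})"
    proof (cases "\<exists>g\<in>F. q \<in> U g")
      case True
      then obtain g where g: "g \<in> F" "q \<in> U g"
        by blast
      have unique: "h = g" if "h \<in> F" "q \<in> U h" for h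
        using code[OF g(2,1)] code[OF that(2,1)] by simp
      have "q \<in> (\<Union>h\<in>F \<inter> Z. U h) \<longleftrightarrow> g \<in> Z"
        using g unique by blast
      moreover have "q \<in> (\<Union>h\<in>F. U h)"
        using g by blast
      moreover have "q \<in> OY"
        using g by (simp add: U_def)
      ultimately show ?thesis
        using code[OF g(2,1)] by (simp add: space_warped_borel)
    next
      case False
      then show ?thesis
        using junk[of q] by (auto simp: space_warped_borel)
    qed
  qed
  moreover have "(\<Union>g\<in>F \<inter> Z. U g) \<in> sets warped.borel_sigma"
    "(\<Union>g\<in>F. U g) \<in> sets warped.borel_sigma"
    using F(1) U by (intro sets.finite_UN; simp)+
  ultimately show "orbit_code F e z -` Z \<inter> space warped.borel_sigma \<in> sets warped.borel_sigma"
    using sets.compl_sets by (cases "\<one> \<in> Z") (simp_all add: sets.Un)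
qed

text \<open>
  On a high level, the measure that property A attaches to \<open>(r, z)\<close> lives near \<open>F z\<close>, so coding
  turns it into a measure \<open>D z\<close> on the group. If \<open>w\<close> is close to \<open>\<gamma> z\<close>, a point near \<open>g z\<close> is near
  \<open>g \<gamma>\<^sup>-\<^sup>1 w\<close>: right translation by \<open>\<gamma>\<^sup>-\<^sup>1\<close> just replaces the code relative to \<open>z\<close> by the code relative
  to \<open>w\<close>. Both sides are then push-forwards under one map of measures attached to nearby points.
\<close>

lemma almost_equivariant_measures:
  assumes free: "acts_freely G Y \<phi>" and prop_A: "warped.property_A"
  shows "\<exists>D d. 0 < d \<and> (\<forall>z\<in>Y. D z \<in> space (prob_algebra (count_space (carrier G)))) \<and>
    (\<forall>\<gamma>\<in>word_ball G S n. \<forall>z\<in>Y. \<forall>w\<in>Y. dist (\<phi> \<gamma> z) w < d \<longrightarrow>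
       tv_dist (right_translate G (D z) (inv \<gamma>)) (D w) \<le> 1 / real (Suc n))"
proof -
  obtain A N where AN: "\<forall>m\<ge>1.
      (\<forall>x\<in>OY. A m x \<in> space (prob_algebra warped.borel_sigma)) \<and>
      (\<forall>x\<in>OY. warped.msupport (A m x) \<subseteq> warped.mball x (real (N m))) \<and>
      (\<forall>x\<in>OY. \<forall>x'\<in>OY. wd x x' \<le> real m \<longrightarrow> tv_dist (A m x) (A m x') \<le> 1 / real m)"
    using prop_A[unfolded warped.property_A_def] by (elim exE) (rule that)
  have A: "A (Suc n) x \<in> space (prob_algebra warped.borel_sigma)"
    "warped.msupport (A (Suc n) x) \<subseteq> warped.mball x (real (N (Suc n)))"
    "x' \<in> OY \<Longrightarrow> wd x x' \<le> real (Suc n) \<Longrightarrow>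
       tv_dist (A (Suc n) x) (A (Suc n) x') \<le> 1 / real (Suc n)" if "x \<in> OY" for x x'
    using spec[OF AN, of "Suc n"] that by simp_all
  obtain F where F: "finite F" "F \<subseteq> carrier G"
    "\<And>e. 0 < e \<Longrightarrow> \<exists>R>0. \<forall>r\<ge>R. \<forall>y\<in>Y. \<forall>q\<in>OY.
       wd (r, y) q < real (N (Suc n)) \<longrightarrow> (\<exists>g\<in>F. dist (snd q) (\<phi> g y) < e)"
    using warped_ball_near_orbit[of "N (Suc n)"] by blast
  define B where "B = word_ball G S n"
  have B: "finite B" "B \<subseteq> carrier G"
    using finite_word_ball[OF finite_S] word_ball_subset_carrier[OF S_subset] by (auto simp: B_def)
  \<comment> \<open>large enough to code the points near \<open>F z\<close> relative to \<open>z\<close> and relative to \<open>\<gamma> z\<close>\<close>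
  define F' where "F' = F \<union> (\<lambda>(g, \<gamma>). g \<otimes> inv \<gamma>) ` (F \<times> B)"
  have F': "finite F'" "F' \<subseteq> carrier G"
    using F(1,2) B by (auto simp: F'_def)
  obtain e0 where e0: "0 < e0"
    "\<And>g h y. g \<in> F' \<Longrightarrow> h \<in> F' \<Longrightarrow> g \<noteq> h \<Longrightarrow> y \<in> Y \<Longrightarrow> e0 \<le> dist (\<phi> g y) (\<phi> h y)"
    using free_finite_separated[OF free F'] by blast
  define e where "e = e0 / 2"
  have e: "0 < e / 2" and sep:
    "\<And>g h y. g \<in> F' \<Longrightarrow> h \<in> F' \<Longrightarrow> g \<noteq> h \<Longrightarrow> y \<in> Y \<Longrightarrow> 2 * e \<le> dist (\<phi> g y) (\<phi> h y)"
    using e0 by (auto simp: e_def)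
  obtain r where r: "0 < r" and near: "\<And>y q. y \<in> Y \<Longrightarrow> q \<in> OY \<Longrightarrow>
      wd (r, y) q < real (N (Suc n)) \<Longrightarrow> \<exists>g\<in>F. dist (snd q) (\<phi> g y) < e / 2"
    using F(3)[OF e] by blast
  obtain d0 where d0: "0 < d0" "\<And>g x y. g \<in> F' \<Longrightarrow> x \<in> Y \<Longrightarrow> y \<in> Y \<Longrightarrow> dist x y < d0 \<Longrightarrow>
      dist (\<phi> g x) (\<phi> g y) < e / 2"
    using uniform_modulus[OF F' e] by blast
  \<comment> \<open>\<open>d0\<close> makes the codes relative to \<open>\<gamma> z\<close> and \<open>w\<close> agree; on level \<open>r\<close>, a displacement
    \<open>1 / r\<close> of the base point costs at most one unit\<close>
  define d where "d = min d0 (1 / r)"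
  define \<mu> where "\<mu> z = A (Suc n) (r, z)" for z
  define D where "D z = distr (\<mu> z) (count_space (carrier G)) (orbit_code F' e z)" for z
  have \<mu>: "\<mu> z \<in> space (prob_algebra warped.borel_sigma)" if "z \<in> Y" for z
    using that A(1) r by (simp add: \<mu>_def in_cone)
  then have \<mu>': "sets (\<mu> z) = sets warped.borel_sigma" "prob_space (\<mu> z)" "space (\<mu> z) = OY"
    if "z \<in> Y" for z
    using that sets_eq_imp_space_eq[of "\<mu> z" warped.borel_sigma] space_warped_borel
    by (auto simp: space_prob_algebra)
  have code: "orbit_code F' e w \<in> measurable (\<mu> z) (count_space (carrier G))"
    if "z \<in> Y" "w \<in> Y" for z w
    using measurable_orbit_code[OF F' sep \<open>w \<in> Y\<close>] measurable_cong_sets[OF \<mu>'(1)[OF \<open>z \<in> Y\<close>] refl]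
    by blast
  have supp: "AE q in \<mu> z. \<exists>g\<in>F. dist (snd q) (\<phi> g z) < e / 2" if z: "z \<in> Y" for z
  proof -
    have "AE q in \<mu> z. wd (r, z) q < real (N (Suc n))"
      using AE_mball_of_msupport[OF \<mu>[OF z]] A(2)[of "(r, z)"] z r
      by (simp add: \<mu>_def in_cone)
    then show ?thesis
      by (rule AE_mp) (intro AE_I2 impI near[OF z], simp_all add: \<mu>'(3)[OF z])
  qed
  have "0 < d"
    using d0(1) r by (simp add: d_def)
  moreover have "D z \<in> space (prob_algebra (count_space (carrier G)))" if "z \<in> Y" for z
    using prob_space.prob_space_distr[OF \<mu>'(2) code] that by (simp add: D_def space_prob_algebra)
  moreover have "tv_dist (right_translate G (D z) (inv \<gamma>)) (D w) \<le> 1 / real (Suc n)"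
    if \<gamma>: "\<gamma> \<in> B" and z: "z \<in> Y" and w: "w \<in> Y" and zw: "dist (\<phi> \<gamma> z) w < d" for \<gamma> z w
  proof -
    have \<gamma>G: "\<gamma> \<in> carrier G" "\<phi> \<gamma> z \<in> Y"
      using \<gamma> B z act_closed by auto
    have shift: "(\<lambda>x. x \<otimes> inv \<gamma>) \<in> measurable (count_space (carrier G)) (count_space (carrier G))"
      using \<gamma>G by simp
    have "right_translate G (D z) (inv \<gamma>) =
        distr (\<mu> z) (count_space (carrier G)) (\<lambda>q. orbit_code F' e z q \<otimes> inv \<gamma>)"
      unfolding right_translate_def D_def by (subst distr_distr[OF shift code[OF z z]]) (simp add: o_def)
    also have "\<dots> = distr (\<mu> z) (count_space (carrier G)) (orbit_code F' e w)"
    proof (rule distr_cong_AE)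
      show "AE q in \<mu> z. orbit_code F' e z q \<otimes> inv \<gamma> = orbit_code F' e w q"
        using supp[OF z]
      proof (rule AE_mp, intro AE_I2 impI)
        fix q :: "real \<times> 'y" assume "\<exists>g\<in>F. dist (snd q) (\<phi> g z) < e / 2"
        then obtain g where g: "g \<in> F" "dist (snd q) (\<phi> g z) < e / 2"
          by blast
        have gF: "g \<in> F'" "g \<otimes> inv \<gamma> \<in> F'" "g \<in> carrier G"
          using g(1) \<gamma> F(2) by (auto simp: F'_def)
        have "orbit_code F' e z q = g"
          using g(2) e by (intro orbit_code_eq[OF sep z gF(1)]) auto
        moreover have "orbit_code F' e w q = g \<otimes> inv \<gamma>"
        proof (rule orbit_code_eq[OF sep w gF(2)])
          have "dist (\<phi> (g \<otimes> inv \<gamma>) (\<phi> \<gamma> z)) (\<phi> (g \<otimes> inv \<gamma>) w) < e / 2"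
            using zw w \<gamma>G gF(2) by (intro d0(2)) (auto simp: d_def)
          moreover have "\<phi> (g \<otimes> inv \<gamma>) (\<phi> \<gamma> z) = \<phi> g z"
            using gF(3) \<gamma>G z by (simp add: act_mult act_inv)
          ultimately show "dist (snd q) (\<phi> (g \<otimes> inv \<gamma>) w) < e"
            using g(2) dist_triangle[of "snd q" "\<phi> (g \<otimes> inv \<gamma>) w" "\<phi> g z"] by simp
        qed
        ultimately show "orbit_code F' e z q \<otimes> inv \<gamma> = orbit_code F' e w q"
          by simp
      qed
      show "(\<lambda>q. orbit_code F' e z q \<otimes> inv \<gamma>) \<in> measurable (\<mu> z) (count_space (carrier G))"
        by (rule measurable_compose[OF code[OF z z] shift])
    qed (use code z w in auto)
    finally have "tv_dist (right_translate G (D z) (inv \<gamma>)) (D w) \<le> tv_dist (\<mu> z) (\<mu> w)"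
      unfolding D_def[of w] using tv_dist_distr_le[OF \<mu>'(2)[OF z] \<mu>'(2)[OF w] _ code[OF z w]]
        \<mu>'(1)[OF z] \<mu>'(1)[OF w] by simp
    also have "\<dots> \<le> 1 / real (Suc n)"
      unfolding \<mu>_def
    proof (rule A(3))
      have "wd (r, z) (r, w) \<le> wd (r, z) (r, \<phi> \<gamma> z) + wd (r, \<phi> \<gamma> z) (r, w)"
        using r z w \<gamma>G by (intro warped.triangle) (auto simp: in_cone)
      also have "wd (r, z) (r, \<phi> \<gamma> z) \<le> real n"
        using wd_word[OF r z] \<gamma> by (simp add: B_def)
      also have "wd (r, \<phi> \<gamma> z) (r, w) \<le> r * dist (\<phi> \<gamma> z) w"
        using wd_le_cone_dist[of "(r, \<phi> \<gamma> z)" "(r, w)"] r w \<gamma>G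
        by (simp add: in_cone cone_dist_def)
      also have "\<dots> \<le> 1"
        using zw r by (simp add: d_def field_simps)
      finally show "wd (r, z) (r, w) \<le> real (Suc n)"
        by simp
    qed (use r z w in \<open>auto simp: in_cone\<close>)
    finally show ?thesis .
  qed
  ultimately show ?thesis
    unfolding B_def by blast
qed

section \<open>Continuity by averaging\<close>

lemma right_translate_in_prob_algebra:
  assumes "\<mu> \<in> space (prob_algebra (count_space (carrier G)))" and "\<gamma> \<in> carrier G"
  shows "right_translate G \<mu> \<gamma> \<in> space (prob_algebra (count_space (carrier G)))"
proof -
  have \<mu>: "sets \<mu> = sets (count_space (carrier G))" "prob_space \<mu>"
    using assms(1) by (auto simp: space_prob_algebra)
  have "(\<lambda>x. x \<otimes> \<gamma>) \<in> measurable \<mu> (count_space (carrier G))"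
    using assms(2) by (simp add: measurable_cong_sets[OF \<mu>(1) refl])
  then show ?thesis
    using prob_space.prob_space_distr[OF \<mu>(2)] by (simp add: right_translate_def space_prob_algebra)
qed

text \<open>
  Averaging over a net with weights from a partition of unity makes the family continuous. Since
  the hypothesis tolerates an error \<open>d\<close> in the base point, the estimate survives for net points near
  \<open>y\<close> and near \<open>\<gamma> y\<close>.
\<close>

lemma continuous_average:
  assumes D: "\<And>z. z \<in> Y \<Longrightarrow> D z \<in> space (prob_algebra (count_space (carrier G)))"
    and B: "finite B" "B \<subseteq> carrier G" and "0 < d"
    and c: "\<And>\<gamma> z w. \<gamma> \<in> B \<Longrightarrow> z \<in> Y \<Longrightarrow> w \<in> Y \<Longrightarrow> dist (\<phi> \<gamma> z) w < d \<Longrightarrow>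
       tv_dist (right_translate G (D z) (inv \<gamma>)) (D w) \<le> c"
  shows "\<exists>C. (\<forall>y\<in>Y. C y \<in> space (prob_algebra (count_space (carrier G)))) \<and>
    (\<forall>y\<in>Y. ((\<lambda>z. tv_dist (C z) (C y)) \<longlongrightarrow> 0) (at y within Y)) \<and>
    (\<forall>\<gamma>\<in>B. \<forall>y\<in>Y. tv_dist (right_translate G (C y) (inv \<gamma>)) (C (\<phi> \<gamma> y)) \<le> c)"
proof -
  let ?K = "count_space (carrier G)"
  obtain d' where d': "0 < d'" "\<And>\<gamma> x y. \<gamma> \<in> B \<Longrightarrow> x \<in> Y \<Longrightarrow> y \<in> Y \<Longrightarrow> dist x y < d' \<Longrightarrow>
      dist (\<phi> \<gamma> x) (\<phi> \<gamma> y) < d / 2"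
    using uniform_modulus[OF B, of "d / 2"] \<open>0 < d\<close> by auto
  define \<delta> where "\<delta> = min d' (d / 2)"
  have "0 < \<delta>"
    using d'(1) \<open>0 < d\<close> by (simp add: \<delta>_def)
  then have "\<exists>T. finite T \<and> T \<subseteq> Y \<and> Y \<subseteq> (\<Union>t\<in>T. ball t \<delta>)"
    by (rule seq_compact_imp_totally_bounded[OF compact_imp_seq_compact[OF compact_Y], rule_format])
  then obtain T where T: "finite T" "T \<subseteq> Y" "Y \<subseteq> (\<Union>t\<in>T. ball t \<delta>)"
    by (elim exE conjE)
  define h where "h t y = max 0 (\<delta> - dist t y)" for t y :: 'y
  define w where "w y t = h t y / (\<Sum>u\<in>T. h u y)" for y t
  have pos: "0 < (\<Sum>u\<in>T. h u y)" if "y \<in> Y" for y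
  proof -
    obtain t where "t \<in> T" "dist t y < \<delta>"
      using T(3) \<open>y \<in> Y\<close> by auto
    then show ?thesis
      using T(1) by (intro sum_pos2[of T t]) (auto simp: h_def)
  qed
  have weights: "convex_weights T (w y)" if "y \<in> Y" for y
    using T(1) pos[OF that] by (auto simp: convex_weights_def w_def h_def sum_nonneg simp flip: sum_divide_distrib)
  have close: "dist t y < \<delta>" if "0 < w y t" "y \<in> Y" for y t
    using that pos[OF that(2)] by (auto simp: w_def h_def zero_less_divide_iff split: if_splits)
  have cont: "continuous_on Y (\<lambda>y. w y t)" for t
    unfolding w_def h_def using pos
    by (intro continuous_intros) (auto simp: h_def less_imp_neq[THEN not_sym])
  define C where "C y = mixture T (w y) D" for y
  have DT: "D t \<in> space (prob_algebra ?K)" if "t \<in> T" for t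
    using that D T(2) by blast
  have C: "C y \<in> space (prob_algebra ?K)" if "y \<in> Y" for y
    unfolding C_def by (rule mixture_in_prob_algebra[OF weights[OF that] DT])
  have "((\<lambda>z. tv_dist (C z) (C y)) \<longlongrightarrow> 0) (at y within Y)" if y: "y \<in> Y" for y
  proof (rule tendsto_sandwich)
    have inY: "\<forall>\<^sub>F z in at y within Y. z \<in> Y"
      by (simp add: eventually_at_filter)
    show "\<forall>\<^sub>F z in at y within Y. 0 \<le> tv_dist (C z) (C y)"
      using inY by eventually_elim (use C y in \<open>auto simp: space_prob_algebra intro!: tv_dist_nonneg\<close>)
    show "\<forall>\<^sub>F z in at y within Y. tv_dist (C z) (C y) \<le> (\<Sum>t\<in>T. \<bar>w z t - w y t\<bar>)"
      using inY by eventually_elim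
        (use y in \<open>auto simp: C_def intro!: tv_dist_mixture_weights_le weights DT\<close>)
    have "((\<lambda>z. \<Sum>t\<in>T. \<bar>w z t - w y t\<bar>) \<longlongrightarrow> (\<Sum>t\<in>T. \<bar>w y t - w y t\<bar>)) (at y within Y)"
      using cont y by (intro tendsto_intros) (simp add: continuous_on_def)
    then show "((\<lambda>z. \<Sum>t\<in>T. \<bar>w z t - w y t\<bar>) \<longlongrightarrow> 0) (at y within Y)"
      by simp
  qed simp
  moreover have "tv_dist (right_translate G (C y) (inv \<gamma>)) (C (\<phi> \<gamma> y)) \<le> c"
    if \<gamma>: "\<gamma> \<in> B" and y: "y \<in> Y" for \<gamma> y
  proof -
    have \<gamma>y: "\<gamma> \<in> carrier G" "\<phi> \<gamma> y \<in> Y"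
      using \<gamma> y B act_closed by auto
    then have shift: "(\<lambda>x. x \<otimes> inv \<gamma>) \<in> measurable ?K ?K"
      by simp
    have "right_translate G (C y) (inv \<gamma>) = mixture T (w y) (\<lambda>t. right_translate G (D t) (inv \<gamma>))"
      unfolding right_translate_def C_def by (rule distr_mixture[OF weights[OF y] DT shift])
    also have "tv_dist \<dots> (C (\<phi> \<gamma> y)) \<le> c"
      unfolding C_def
    proof (rule tv_dist_mixture_le[OF weights[OF y] weights[OF \<gamma>y(2)] _ DT])
      show "right_translate G (D t) (inv \<gamma>) \<in> space (prob_algebra ?K)" if "t \<in> T" for t
        using right_translate_in_prob_algebra[OF DT[OF that]] \<gamma>y(1) by simp
      fix t u assume tu: "t \<in> T" "u \<in> T" "0 < w y t" "0 < w (\<phi> \<gamma> y) u"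
      have "dist (\<phi> \<gamma> t) (\<phi> \<gamma> y) < d / 2"
        using close[OF tu(3) y] tu(1) T(2) \<gamma> y by (intro d'(2)) (auto simp: \<delta>_def)
      moreover have "dist u (\<phi> \<gamma> y) < d / 2"
        using close[OF tu(4) \<gamma>y(2)] by (simp add: \<delta>_def)
      ultimately have "dist (\<phi> \<gamma> t) u < d"
        using dist_triangle2[of "\<phi> \<gamma> t" u "\<phi> \<gamma> y"] by linarith
      then show "tv_dist (right_translate G (D t) (inv \<gamma>)) (D u) \<le> c"
        using tu T(2) \<gamma> by (intro c) auto
    qed
    finally show ?thesis .
  qed
  ultimately show ?thesis
    using C by blast
qed

section \<open>Amenability\<close>

text \<open>
  Every group element lies in some word ball, hence is controlled by all but finitely many of the
  averaged families.
\<close>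

lemma amenable_of_property_A:
  assumes gen: "generate G S = carrier G" and free: "acts_freely G Y \<phi>"
    and prop_A: "warped.property_A"
  shows "amenable_action G Y \<phi>"
proof -
  let ?K = "count_space (carrier G)"
  have "\<exists>C. (\<forall>y\<in>Y. C y \<in> space (prob_algebra ?K)) \<and>
    (\<forall>y\<in>Y. ((\<lambda>z. tv_dist (C z) (C y)) \<longlongrightarrow> 0) (at y within Y)) \<and>
    (\<forall>\<gamma>\<in>word_ball G S n. \<forall>y\<in>Y.
       tv_dist (right_translate G (C y) (inv \<gamma>)) (C (\<phi> \<gamma> y)) \<le> 1 / real (Suc n))" for n
  proof -
    obtain D d where "0 < d" "\<And>z. z \<in> Y \<Longrightarrow> D z \<in> space (prob_algebra ?K)"
      "\<And>\<gamma> z w. \<gamma> \<in> word_ball G S n \<Longrightarrow> z \<in> Y \<Longrightarrow> w \<in> Y \<Longrightarrow> dist (\<phi> \<gamma> z) w < d \<Longrightarrow>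
         tv_dist (right_translate G (D z) (inv \<gamma>)) (D w) \<le> 1 / real (Suc n)"
      using almost_equivariant_measures[OF free prop_A, of n] by blast
    then show ?thesis
      by (intro continuous_average finite_word_ball[OF finite_S] word_ball_subset_carrier[OF S_subset])
  qed
  then obtain C where "\<forall>n. (\<forall>y\<in>Y. C n y \<in> space (prob_algebra ?K)) \<and>
    (\<forall>y\<in>Y. ((\<lambda>z. tv_dist (C n z) (C n y)) \<longlongrightarrow> 0) (at y within Y)) \<and>
    (\<forall>\<gamma>\<in>word_ball G S n. \<forall>y\<in>Y.
       tv_dist (right_translate G (C n y) (inv \<gamma>)) (C n (\<phi> \<gamma> y)) \<le> 1 / real (Suc n))"
    using choice[of "\<lambda>n C. (\<forall>y\<in>Y. C y \<in> space (prob_algebra ?K)) \<and>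
      (\<forall>y\<in>Y. ((\<lambda>z. tv_dist (C z) (C y)) \<longlongrightarrow> 0) (at y within Y)) \<and>
      (\<forall>\<gamma>\<in>word_ball G S n. \<forall>y\<in>Y.
         tv_dist (right_translate G (C y) (inv \<gamma>)) (C (\<phi> \<gamma> y)) \<le> 1 / real (Suc n))"] by auto
  then have C:
    "\<And>n y. y \<in> Y \<Longrightarrow> C n y \<in> space (prob_algebra ?K)"
    "\<And>n y. y \<in> Y \<Longrightarrow> ((\<lambda>z. tv_dist (C n z) (C n y)) \<longlongrightarrow> 0) (at y within Y)"
    "\<And>n \<gamma> y. \<gamma> \<in> word_ball G S n \<Longrightarrow> y \<in> Y \<Longrightarrow>
       tv_dist (right_translate G (C n y) (inv \<gamma>)) (C n (\<phi> \<gamma> y)) \<le> 1 / real (Suc n)"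
    by blast+
  have "(\<lambda>n. SUP y\<in>Y. tv_dist (right_translate G (C n y) (inv \<gamma>)) (C n (\<phi> \<gamma> y))) \<longlonglongrightarrow> 0"
    if \<gamma>: "\<gamma> \<in> carrier G" for \<gamma>
  proof (rule tendsto_sandwich)
    let ?t = "\<lambda>n y. tv_dist (right_translate G (C n y) (inv \<gamma>)) (C n (\<phi> \<gamma> y))"
    obtain k where k: "\<gamma> \<in> word_ball G S k"
      using \<gamma> gen generate_subset_word_balls[OF S_subset] by blast
    have bound: "?t n y \<le> 1 / real (Suc n)" if "k \<le> n" "y \<in> Y" for n y
      by (rule C(3)[OF subsetD[OF word_ball_mono[OF that(1)] k] that(2)])
    have nonneg: "0 \<le> ?t n y" if y: "y \<in> Y" for n y
    proof (rule tv_dist_nonneg)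
      have "right_translate G (C n y) (inv \<gamma>) \<in> space (prob_algebra ?K)"
        "C n (\<phi> \<gamma> y) \<in> space (prob_algebra ?K)"
        using \<gamma> y by (simp_all add: right_translate_in_prob_algebra C(1) act_closed)
      then show "prob_space (right_translate G (C n y) (inv \<gamma>))" "prob_space (C n (\<phi> \<gamma> y))"
        "sets (C n (\<phi> \<gamma> y)) = sets (right_translate G (C n y) (inv \<gamma>))"
        by (simp_all add: space_prob_algebra)
    qed
    show "\<forall>\<^sub>F n in sequentially. (SUP y\<in>Y. ?t n y) \<le> 1 / real (Suc n)"
      using eventually_ge_at_top[of k] by eventually_elim (intro cSUP_least Y_nonempty bound)
    show "\<forall>\<^sub>F n in sequentially. 0 \<le> (SUP y\<in>Y. ?t n y)"
      using eventually_ge_at_top[of k]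
    proof eventually_elim
      case (elim n)
      obtain y where y: "y \<in> Y"
        using Y_nonempty by blast
      have "?t n y \<le> (SUP y\<in>Y. ?t n y)"
        using y bound[OF elim] by (intro cSUP_upper bdd_aboveI2[of _ _ "1 / real (Suc n)"])
      then show ?case
        using nonneg[OF y, of n] by linarith
    qed
    show "(\<lambda>n. 1 / real (Suc n)) \<longlonglongrightarrow> 0"
      using LIMSEQ_inverse_real_of_nat by (simp add: inverse_eq_divide)
  qed simp
  then show ?thesis
    unfolding amenable_action_def using C(1,2) by (intro exI[of _ C]) blast
qed

end

theorem theoremA:
  fixes G :: "('g, 'b) monoid_scheme"
    and S :: "'g set"
    and Y :: "'y::metric_space set"
    and \<phi> :: "'g \<Rightarrow> 'y \<Rightarrow> 'y"
  assumes "group G"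
    and "finite S" and "S \<subseteq> carrier G" and "generate G S = carrier G"
    and "compact Y" and "0 < diameter Y"
    and "acts_continuously G Y \<phi>"
    and "acts_freely G Y \<phi>"
    and "Metric_space.property_A (inf_cone Y) (warped_dist Y \<phi> S)"
  shows "amenable_action G Y \<phi>"
proof -
  interpret compact_action G S Y \<phi>
    using assms by (intro compact_action.intro compact_action_axioms.intro)
  show ?thesis
    using assms by (intro amenable_of_property_A)
qed

end
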